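(* Let $X$ be a surjective shift space (i.e. $\sigma(X)=X$). Then $X$ has the vague specification property if and only if $X$ is $\bar d$-complete and has the $\bar d$-shadowing property.
   Context: $\mathbb{N}_0=\{0,1,2,\ldots\}$, $\mathbb{N}=\{1,2,\ldots\}$. Let $\mathscr{A}=\{0,1\}$ and let $\mathscr{A}^\infty$ be the set of all sequences $x=\{x_n\}_{n=0}^\infty$ over $\mathscr{A}$, with the product topology and the metric $\rho(x,y)=0$ if $x=y$ and $\rho(x,y)=2^{-\min\{n: x_n\ne y_n\}}$ otherwise. The shift map is $\sigma(x)=\{x_{n+1}\}_{n=0}^\infty$. A shift space is a nonempty, closed, $\sigma$-invariant set $X\subseteq\mathscr{A}^\infty$, viewed as the topological dynamical system $(X,\sigma)$. Its language $\mathcal{L}(X)$ is the set of finite words $w$ over $\mathscr{A}$ such that some $x\in X$ begins with $w$; $|w|$ denotes the length of $w$. For $x,y\in\mathscr{A}^\infty$ let $\bar d(x,y)=\limsup_{n\to\infty}\frac1n|\{i\in[0,n): x_i\ne y_i\}|$ (a pseudometric). $X$ is $\bar d$-complete if for every sequence $\{z^{(n)}\}_{n=1}^\infty\subset X$ that is Cauchy for $\bar d$ there is $z\in X$ with $\lim_{n\to\infty}\bar d(z^{(n)},z)=0$. $\bar d$-shadowing property: for every $\varepsilon>0$ there is $N\in\mathbb{N}$ such that for every sequence $\{w^{(i)}\}_{i=1}^\infty\subset\mathcal{L}(X)$ with $|w^{(i)}|\ge N$ for all $i$ there is $x\in X$ with $\bar d(x,w)<\varepsilon$, where $w=w^{(1)}w^{(2)}\ldots\in\mathscr{A}^\infty$.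 For $A\subseteq\mathbb{N}_0$ we write $d(A)=1$ if $\lim_{n\to\infty}\frac{|A\cap[0,n)|}{n}=1$. $X^\infty$ is the set of all sequences $\underline{x}=\{x^{(n)}\}_{n=0}^\infty$ of points of $X$, with the product topology; $S(\underline{x})=\{x^{(n+1)}\}_{n=0}^\infty$; $\Gamma_\sigma=\{\{\sigma^n(z)\}_{n=0}^\infty: z\in X\}\subseteq X^\infty$. Vague pseudo-orbit: $\underline{x}\in X^\infty$ such that for every open set $\mathcal{U}\subseteq X^\infty$ containing $\Gamma_\sigma$, $d(\{n\in\mathbb{N}_0: S^n(\underline{x})\in\mathcal{U}\})=1$. Vague specification property: for every vague pseudo-orbit $\underline{x}\in X^\infty$ there is $z\in X$ such that for every $\varepsilon>0$, $d(\{n\in\mathbb{N}_0:\rho(\sigma^n(z),x^{(n)})<\varepsilon\})=1$. *)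

theory Defs
  imports "HOL-Analysis.Analysis"
begin

text \<open>The alphabet \<open>{0,1}\<close> is \<^typ>\<open>bool\<close> with the library's discrete topology, so
  \<^typ>\<open>nat \<Rightarrow> bool\<close> carries the product topology.\<close>

type_synonym binseq = "nat \<Rightarrow> bool"

definition rho :: "binseq \<Rightarrow> binseq \<Rightarrow> real" where
  "rho x y = (if x = y then 0 else 1 / 2 ^ (LEAST n. x n \<noteq> y n))"

text \<open>Polymorphic: used for sequences over the alphabet and for sequences of points.\<close>

definition shift :: "(nat \<Rightarrow> 'a) \<Rightarrow> nat \<Rightarrow> 'a" where
  "shift x = (\<lambda>n. x (Suc n))"

definition shift_space :: "binseq set \<Rightarrow> bool" where
  "shift_space X \<longleftrightarrow> X \<noteq> {} \<and> closed X \<and> shift ` X \<subseteq> X"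

definition language :: "binseq set \<Rightarrow> bool list set" where
  "language X = {w. \<exists>x\<in>X. map x [0..<length w] = w}"

definition dbar :: "binseq \<Rightarrow> binseq \<Rightarrow> real" where
  "dbar x y = real_of_ereal
     (limsup (\<lambda>n. ereal (real (card {i \<in> {0..<n}. x i \<noteq> y i}) / real n)))"

text \<open>The limit superior is finite, so \<^const>\<open>real_of_ereal\<close> loses nothing.\<close>

lemma ereal_dbar:
  "ereal (dbar x y) = limsup (\<lambda>n. ereal (real (card {i \<in> {0..<n}. x i \<noteq> y i}) / real n))"
    (is "_ = limsup ?f")
proof -
  have le: "?f n \<le> 1" for n
  proof -
    have "card {i \<in> {0..<n}. x i \<noteq> y i} \<le> card {0..<n}"
      by (intro card_mono) auto
    then show ?thesis
      by (cases "n = 0") (simp_all add: divide_le_eq_1 one_ereal_def)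
  qed
  have ge: "0 \<le> ?f n" for n
    by simp
  have "limsup ?f \<le> limsup (\<lambda>n::nat. 1 :: ereal)"
    by (intro Limsup_mono always_eventually allI le)
  then have "limsup ?f \<le> 1"
    by (simp add: Limsup_const)
  moreover have "limsup (\<lambda>n::nat. 0 :: ereal) \<le> limsup ?f"
    by (intro Limsup_mono always_eventually allI ge)
  then have "0 \<le> limsup ?f"
    by (simp add: Limsup_const)
  ultimately have "\<bar>limsup ?f\<bar> \<noteq> \<infinity>"
    by auto
  then show ?thesis
    unfolding dbar_def by (rule ereal_real')
qed

definition dbar_complete :: "binseq set \<Rightarrow> bool" where
  "dbar_complete X \<longleftrightarrow>
     (\<forall>z :: nat \<Rightarrow> binseq.
        (\<forall>n. z n \<in> X) \<and> (\<forall>\<epsilon>>0. \<exists>M. \<forall>m\<ge>M. \<forall>n\<ge>M. dbar (z m) (z n) < \<epsilon>) \<longrightarrow>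
        (\<exists>z'\<in>X. (\<lambda>n. dbar (z n) z') \<longlonglongrightarrow> 0))"

text \<open>The infinite concatenation \<open>w 0 w 1 w 2 \<dots>\<close>; meaningful when all \<open>w i\<close> are nonempty, since
  then the first \<open>n + 1\<close> words already determine the symbol at position \<open>n\<close>.\<close>

definition infinite_concat :: "(nat \<Rightarrow> 'a list) \<Rightarrow> nat \<Rightarrow> 'a" where
  "infinite_concat w n = concat (map w [0..<Suc n]) ! n"

lemma infinite_concat_prefix:
  assumes "\<And>i. w i \<noteq> []"
  shows "map (infinite_concat w) [0..<length (concat (map w [0..<k]))] = concat (map w [0..<k])"
proof (rule nth_equalityI)
  let ?c = "\<lambda>k. concat (map w [0..<k])"
  have len: "k \<le> length (?c k)" for k
  proof (induction k)
    case (Suc k)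
    have "length (w k) > 0"
      using assms by simp
    then have "Suc k \<le> length (?c k) + length (w k)"
      using Suc by linarith
    then show ?case
      by simp
  qed simp
  have prefix: "?c (k + m) ! n = ?c k ! n" if "n < length (?c k)" for k m n
  proof -
    have "[0..<k + m] = [0..<k] @ [k..<k + m]"
      by (rule upt_add_eq_append) simp
    with that show ?thesis
      by (simp add: nth_append)
  qed
  fix n assume "n < length (map (infinite_concat w) [0..<length (?c k)])"
  then have n: "n < length (?c k)"
    by simp
  have n': "n < length (?c (Suc n))"
    using len[of "Suc n"] by linarith
  have "?c (Suc n) ! n = ?c (k + Suc n) ! n"
    using prefix[OF n', of k] by (simp only: add.commute)
  also have "\<dots> = ?c k ! n"
    using prefix[OF n] .
  finally show "map (infinite_concat w) [0..<length (?c k)] ! n = ?c k ! n"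
    using n by (simp add: infinite_concat_def)
qed simp

definition dbar_shadowing :: "binseq set \<Rightarrow> bool" where
  "dbar_shadowing X \<longleftrightarrow>
     (\<forall>\<epsilon>>0. \<exists>N\<ge>1. \<forall>w :: nat \<Rightarrow> bool list.
        (\<forall>i. w i \<in> language X \<and> length (w i) \<ge> N) \<longrightarrow>
        (\<exists>x\<in>X. dbar x (infinite_concat w) < \<epsilon>))"

definition density_one :: "nat set \<Rightarrow> bool" where
  "density_one A \<longleftrightarrow> (\<lambda>n. real (card (A \<inter> {0..<n})) / real n) \<longlonglongrightarrow> 1"

definition seq_topology :: "binseq set \<Rightarrow> (nat \<Rightarrow> binseq) topology" where
  "seq_topology X = product_topology (\<lambda>_. top_of_set X) UNIV"

definition orbit_set :: "binseq set \<Rightarrow> (nat \<Rightarrow> binseq) set" where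
  "orbit_set X = {(\<lambda>n. (shift ^^ n) z) | z. z \<in> X}"

definition vague_pseudo_orbit :: "binseq set \<Rightarrow> (nat \<Rightarrow> binseq) \<Rightarrow> bool" where
  "vague_pseudo_orbit X xs \<longleftrightarrow>
     (\<forall>n. xs n \<in> X) \<and>
     (\<forall>U. openin (seq_topology X) U \<and> orbit_set X \<subseteq> U \<longrightarrow>
        density_one {n. (shift ^^ n) xs \<in> U})"

definition vague_specification :: "binseq set \<Rightarrow> bool" where
  "vague_specification X \<longleftrightarrow>
     (\<forall>xs. vague_pseudo_orbit X xs \<longrightarrow>
        (\<exists>z\<in>X. \<forall>\<epsilon>>0. density_one {n. rho ((shift ^^ n) z) (xs n) < \<epsilon>}))"

end

theory Submission
  imports Defs
begin

text \<open>A vague pseudo-orbit is determined, up to density zero, by its zeroth symbols, and the sequences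
  \<open>f\<close> that arise in this way are those whose windows \<open>f[n, n + K)\<close> lie in the language for
  density-one many \<open>n\<close>, for each \<open>K\<close>. Hence vague specification says that each such \<open>f\<close> is at
  \<open>dbar\<close>-distance zero from a point of \<open>X\<close>.

  Given completeness and shadowing, cut \<open>f\<close> into words of fixed length \<open>N\<close>, repair the density-zero many
  words outside the language, shadow, and let \<open>N\<close> grow. For the converse, splice sequences along rapidly
  growing blocks. Terms of a \<open>dbar\<close>-Cauchy sequence spliced in this way converge to the splice, which gives
  completeness. If shadowing fails at \<open>\<epsilon>\<close>, then for each \<open>N\<close> some concatenation of words longer than \<open>N\<close>
  has arbitrarily long segments at Hamming distance more than \<open>\<epsilon>/2\<close> from all words of the language: otherwise
  close words on consecutive blocks of slowly increasing length could be spliced to a traceable sequence. Splicing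
  such bad segments for \<open>N \<longrightarrow> \<infinity>\<close> contradicts tracing.\<close>

section \<open>Upper asymptotic density\<close>

text \<open>The limsup of \<open>card (A \<inter> {..<T}) / T\<close> is at most \<open>e\<close>,
  multiplied out to avoid quotients and extended reals.\<close>

definition upper_density_le :: "nat set \<Rightarrow> real \<Rightarrow> bool" where
  "upper_density_le A e \<longleftrightarrow> (\<forall>d>e. \<forall>\<^sub>F T in sequentially. real (card (A \<inter> {..<T})) \<le> d * real T)"

text \<open>A constant \<open>c\<close> costs nothing asymptotically: the slope \<open>d'\<close>
  halfway between \<open>e\<close> and \<open>d\<close> leaves a surplus \<open>(d - d') * T\<close>
  that exceeds \<open>c\<close> for large \<open>T\<close>. Counting arguments can thus charge a
  fixed initial segment to \<open>c\<close>.\<close>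

lemma upper_density_leI:
  assumes "\<And>d. d > e \<Longrightarrow> \<exists>c. \<forall>T. real (card (A \<inter> {..<T})) \<le> d * real T + c"
  shows "upper_density_le A e"
  unfolding upper_density_le_def
proof (intro allI impI)
  fix d :: real assume "d > e"
  define d' where "d' = (d + e) / 2"
  have d': "e < d'" "d' < d" using \<open>d > e\<close> by (auto simp: d'_def)
  from assms[OF d'(1)] obtain c where c: "\<And>T. real (card (A \<inter> {..<T})) \<le> d' * real T + c"
    by blast
  obtain N :: nat where N: "c / (d - d') \<le> real N" using real_arch_simple by blast
  show "\<forall>\<^sub>F T in sequentially. real (card (A \<inter> {..<T})) \<le> d * real T"
    unfolding eventually_sequentially
  proof (intro exI allI impI)
    fix T assume "N \<le> T"
    then have "c / (d - d') \<le> real T" using N by linarith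
    then have "c \<le> (d - d') * real T" using d' by (simp add: field_simps)
    then show "real (card (A \<inter> {..<T})) \<le> d * real T" using c[of T] by (simp add: algebra_simps)
  qed
qed

lemma upper_density_le_mono: "upper_density_le B e \<Longrightarrow> A \<subseteq> B \<Longrightarrow> upper_density_le A e"
  unfolding upper_density_le_def
proof (intro allI impI)
  fix d assume *: "\<forall>d>e. \<forall>\<^sub>F T in sequentially. real (card (B \<inter> {..<T})) \<le> d * real T" 
    "A \<subseteq> B" "e < d"
  then have "\<forall>\<^sub>F T in sequentially. real (card (B \<inter> {..<T})) \<le> d * real T" by blast
  then show "\<forall>\<^sub>F T in sequentially. real (card (A \<inter> {..<T})) \<le> d * real T"
  proof eventually_elim
    case (elim T)
    have "card (A \<inter> {..<T}) \<le> card (B \<inter> {..<T})" using * by (intro card_mono) auto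
    then show ?case using elim by linarith
  qed
qed

lemma upper_density_le_Un:
  assumes "upper_density_le A a" "upper_density_le B b"
  shows "upper_density_le (A \<union> B) (a + b)"
  unfolding upper_density_le_def
proof (intro allI impI)
  fix d assume d: "a + b < d"
  define r where "r = (d - a - b) / 2"
  have "r > 0" using d by (simp add: r_def)
  have "\<forall>\<^sub>F T in sequentially. real (card (A \<inter> {..<T})) \<le> (a + r) * real T"
    "\<forall>\<^sub>F T in sequentially. real (card (B \<inter> {..<T})) \<le> (b + r) * real T"
    using assms \<open>r > 0\<close> unfolding upper_density_le_def by auto
  then show "\<forall>\<^sub>F T in sequentially. real (card ((A \<union> B) \<inter> {..<T})) \<le> d * real T"
  proof eventually_elim
    case (elim T)
    have "card ((A \<union> B) \<inter> {..<T}) \<le> card (A \<inter> {..<T}) + card (B \<inter> {..<T})"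
      by (simp add: Int_Un_distrib2 card_Un_le)
    moreover have "(a + r) * real T + (b + r) * real T = d * real T"
      by (simp add: r_def field_simps)
    ultimately show ?case using elim by linarith
  qed
qed

lemma upper_density_0_Un: "upper_density_le A 0 \<Longrightarrow> upper_density_le B 0 \<Longrightarrow> upper_density_le (A \<union> B) 0"
  using upper_density_le_Un[of A 0 B 0] by simp

lemma upper_density_0_finite: "finite A \<Longrightarrow> upper_density_le A 0"
proof (rule upper_density_leI)
  fix d :: real assume A: "finite A" and d: "0 < d"
  have "real (card (A \<inter> {..<T})) \<le> d * real T + real (card A)" for T
  proof -
    have "card (A \<inter> {..<T}) \<le> card A" using A by (intro card_mono) auto
    moreover have "0 \<le> d * real T" using d by simp
    ultimately show ?thesis by linarith
  qed
  then show "\<exists>c. \<forall>T. real (card (A \<inter> {..<T})) \<le> d * real T + c" by blast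
qed

lemma upper_density_0_UN_less:
  "(\<And>j. j < K \<Longrightarrow> upper_density_le (A j) 0) \<Longrightarrow> upper_density_le (\<Union>j<K. A j) 0" for K :: nat
proof (induction K)
  case (Suc K)
  have "upper_density_le (A K \<union> (\<Union>j<K. A j)) 0" using Suc by (intro upper_density_0_Un) auto
  then show ?case by (simp add: lessThan_Suc)
qed (simp add: upper_density_0_finite)

text \<open>Adding \<open>j\<close> is injective into the positions below \<open>T + j\<close>, and
  \<open>T + j \<le> 2 * T\<close> once \<open>j \<le> T\<close>; hence the slope
  \<open>d / 2\<close> for \<open>A\<close>.\<close>

lemma upper_density_0_translate:
  assumes "upper_density_le A 0"
  shows "upper_density_le {n. n + j \<in> A} 0"
  unfolding upper_density_le_def
proof (intro allI impI)
  fix d :: real assume "0 < d"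
  then have "\<forall>\<^sub>F T in sequentially. real (card (A \<inter> {..<T})) \<le> d / 2 * real T"
    using assms[unfolded upper_density_le_def, rule_format, of "d / 2"] by simp
  then have "\<forall>\<^sub>F T in sequentially. real (card (A \<inter> {..<T + j})) \<le> d / 2 * real (T + j)"
    by (rule eventually_all_ge_at_top[THEN eventually_mono]) (use le_add1 in blast)
  moreover have "\<forall>\<^sub>F T in sequentially. j \<le> T" by (rule eventually_ge_at_top)
  ultimately show "\<forall>\<^sub>F T in sequentially. real (card ({n. n + j \<in> A} \<inter> {..<T})) \<le> d * real T"
  proof eventually_elim
    case (elim T)
    have "card ({n. n + j \<in> A} \<inter> {..<T}) \<le> card (A \<inter> {..<T + j})"
      by (rule card_inj_on_le[where f = "\<lambda>n. n + j"]) (auto simp: inj_on_def)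
    moreover have "d / 2 * real (T + j) \<le> d / 2 * real (T + T)"
      using elim \<open>0 < d\<close> by (intro mult_left_mono) auto
    moreover have "d / 2 * real (T + T) = d * real T" by (simp add: field_simps)
    ultimately show ?case using elim by linarith
  qed
qed

lemma card_separated_le:
  fixes C :: "nat set"
  assumes "0 < M" and sep: "\<And>x y. x \<in> C \<Longrightarrow> y \<in> C \<Longrightarrow> x < y \<Longrightarrow> x + M \<le> y"
  shows "card (C \<inter> {..<T}) \<le> T div M + 1"
proof -
  have less: "x div M < y div M" if "x \<in> C" "y \<in> C" "x < y" for x y
  proof -
    have "(x + M) div M \<le> y div M" by (rule div_le_mono) (rule sep[OF that])
    then show ?thesis using \<open>0 < M\<close> by simp
  qed
  have "card (C \<inter> {..<T}) \<le> card {..T div M}"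
  proof (rule card_inj_on_le[where f = "\<lambda>x. x div M"])
    show "inj_on (\<lambda>x. x div M) (C \<inter> {..<T})"
      by (rule inj_onI) (metis IntE less less_irrefl linorder_neqE_nat)
  qed (auto intro: div_le_mono)
  then show ?thesis by simp
qed

text \<open>Beyond \<open>N\<close> the points are \<open>Suc M\<close> apart and have density at
  most \<open>1 / Suc M < d\<close>; the first \<open>N\<close> positions go into the additive
  constant.\<close>

lemma upper_density_0_sparse:
  fixes B :: "nat set"
  assumes "\<And>M. \<exists>N. \<forall>x\<in>B. \<forall>y\<in>B. N \<le> x \<and> x < y \<longrightarrow> x + M \<le> y"
  shows "upper_density_le B 0"
proof (rule upper_density_leI)
  fix d :: real assume "0 < d"
  obtain M :: nat where M: "inverse (real (Suc M)) < d" using reals_Archimedean[OF \<open>0 < d\<close>] by blast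
  obtain N where N: "\<forall>x\<in>B. \<forall>y\<in>B. N \<le> x \<and> x < y \<longrightarrow> x + Suc M \<le> y" using assms by blast
  have "real (card (B \<inter> {..<T})) \<le> d * real T + (real N + 1)" for T
  proof -
    have "card (B \<inter> {..<T}) \<le> card ({..<N} \<union> ((B \<inter> {N..}) \<inter> {..<T}))"
      by (intro card_mono) auto
    also have "\<dots> \<le> N + card ((B \<inter> {N..}) \<inter> {..<T})"
      using card_Un_le[of "{..<N}"] by simp
    also have "\<dots> \<le> N + (T div Suc M + 1)"
      using N by (intro add_left_mono card_separated_le) auto
    finally have "real (card (B \<inter> {..<T})) \<le> real N + (real (T div Suc M) + 1)" by linarith
    also have "real (T div Suc M) * real (Suc M) \<le> real T"
      by (metis div_times_less_eq_dividend of_nat_le_iff of_nat_mult)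
    then have "real (T div Suc M) \<le> real T / real (Suc M)" by (simp add: field_simps)
    also have "\<dots> \<le> d * real T"
      using M mult_right_mono[of "inverse (real (Suc M))" d "real T"] by (simp add: field_simps)
    finally show ?thesis by simp
  qed
  then show "\<exists>c. \<forall>T. real (card (B \<inter> {..<T})) \<le> d * real T + c" by blast
qed

section \<open>Density one and \<open>dbar\<close> in terms of upper density\<close>

lemma density_one_iff: "density_one A \<longleftrightarrow> upper_density_le (- A) 0"
proof -
  let ?a = "\<lambda>n. real (card (A \<inter> {0..<n})) / real n"
  let ?b = "\<lambda>n. real (card (- A \<inter> {..<n})) / real n"
  have ab: "?b n = 1 - ?a n" if "n > 0" for n
  proof -
    have "card ((A \<inter> {0..<n}) \<union> (- A \<inter> {..<n})) = card (A \<inter> {0..<n}) + card (- A \<inter> {..<n})"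
      by (rule card_Un_disjoint) auto
    moreover have "(A \<inter> {0..<n}) \<union> (- A \<inter> {..<n}) = {..<n}" by auto
    ultimately have "real n = real (card (A \<inter> {0..<n})) + real (card (- A \<inter> {..<n}))"
      by (metis card_lessThan of_nat_add)
    then show ?thesis using that by (simp add: field_simps)
  qed
  have "density_one A \<longleftrightarrow> (\<lambda>n. 1 - ?a n) \<longlonglongrightarrow> 0"
    unfolding density_one_def
    using tendsto_diff[of "\<lambda>_. 1::real" 1 sequentially ?a 1] 
      tendsto_diff[of "\<lambda>_. 1::real" 1 sequentially "\<lambda>n. 1 - ?a n" 0] by auto
  \<comment> \<open>At \<open>n = 0\<close> both quotients are 0 and \<open>ab\<close> fails, so the
    sequences are compared only for positive \<open>n\<close>.\<close>
  also have "\<dots> \<longleftrightarrow> ?b \<longlonglongrightarrow> 0"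
    by (rule tendsto_cong) (use ab in \<open>auto intro: eventually_mono[OF eventually_gt_at_top[of 0]]\<close>)
  also have "\<dots> \<longleftrightarrow> upper_density_le (- A) 0"
  proof
    assume *: "?b \<longlonglongrightarrow> 0"
    show "upper_density_le (- A) 0"
      unfolding upper_density_le_def
    proof (intro allI impI)
      fix d :: real assume "d > 0"
      from order_tendstoD(2)[OF * this] eventually_gt_at_top[of 0]
      show "\<forall>\<^sub>F T in sequentially. real (card (- A \<inter> {..<T})) \<le> d * real T"
        by eventually_elim (simp add: field_simps)
    qed
  next
    assume *: "upper_density_le (- A) 0"
    show "?b \<longlonglongrightarrow> 0"
    proof (rule order_tendstoI)
      fix d :: real assume "0 < d"
      then have "\<forall>\<^sub>F T in sequentially. real (card (- A \<inter> {..<T})) \<le> d / 2 * real T"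
        using *[unfolded upper_density_le_def, rule_format, of "d / 2"] by simp
      with eventually_gt_at_top[of 0] show "\<forall>\<^sub>F n in sequentially. ?b n < d"
      proof eventually_elim
        case (elim n)
        then have "?b n \<le> d / 2" by (simp add: field_simps)
        then show ?case using \<open>0 < d\<close> by linarith
      qed
    qed (auto intro!: always_eventually intro: less_le_trans)
  qed
  finally show ?thesis .
qed

text \<open>The link between \<open>dbar\<close> and density: distance estimates become counts of
  mismatches. Passing between weak bounds and the strict ones of \<open>Limsup_le_iff\<close> costs
  a slope \<open>d'\<close> between \<open>e\<close> and \<open>d\<close>.\<close>

lemma dbar_le_iff: "dbar x y \<le> e \<longleftrightarrow> upper_density_le {i. x i \<noteq> y i} e"
proof -
  let ?f = "\<lambda>n. real (card {i \<in> {0..<n}. x i \<noteq> y i}) / real n"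
  have card: "card {i \<in> {0..<n}. x i \<noteq> y i} = card ({i. x i \<noteq> y i} \<inter> {..<n})" for n
    by (rule arg_cong[where f = card]) auto
  have "dbar x y \<le> e \<longleftrightarrow> limsup (\<lambda>n. ereal (?f n)) \<le> ereal e"
    by (subst ereal_dbar[symmetric]) simp
  also have "\<dots> \<longleftrightarrow> (\<forall>d>e. \<forall>\<^sub>F n in sequentially. ?f n < d)"
  proof
    assume "limsup (\<lambda>n. ereal (?f n)) \<le> ereal e"
    then have *: "\<forall>y>ereal e. \<forall>\<^sub>F n in sequentially. ereal (?f n) < y" by (simp add: Limsup_le_iff)
    show "\<forall>d>e. \<forall>\<^sub>F n in sequentially. ?f n < d"
      using *[rule_format, of "ereal d" for d] by simp
  next
    assume *: "\<forall>d>e. \<forall>\<^sub>F n in sequentially. ?f n < d"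
    show "limsup (\<lambda>n. ereal (?f n)) \<le> ereal e"
      unfolding Limsup_le_iff
    proof (intro allI impI)
      fix y assume "ereal e < y"
      then obtain d where d: "ereal e < ereal d" "ereal d < y" using ereal_dense2 by blast
      then have "\<forall>\<^sub>F n in sequentially. ?f n < d" using * by auto
      then show "\<forall>\<^sub>F n in sequentially. ereal (?f n) < y"
        by eventually_elim (use d in \<open>auto intro: less_trans[of _ "ereal d"]\<close>)
    qed
  qed
  also have "\<dots> \<longleftrightarrow> upper_density_le {i. x i \<noteq> y i} e"
    unfolding upper_density_le_def
  proof (intro iffI allI impI)
    fix d assume *: "\<forall>d>e. \<forall>\<^sub>F n in sequentially. ?f n < d" "e < d"
    then have "\<forall>\<^sub>F n in sequentially. ?f n < d" by blast
    with eventually_gt_at_top[of 0]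
    show "\<forall>\<^sub>F T in sequentially. real (card ({i. x i \<noteq> y i} \<inter> {..<T})) \<le> d * real T"
      by eventually_elim (simp only: card, simp add: field_simps)
  next
    fix d assume *: "\<forall>d>e. \<forall>\<^sub>F T in sequentially. real (card ({i. x i \<noteq> y i} \<inter> {..<T})) \<le> d * real T" "e < d"
    then obtain d' where d': "e < d'" "d' < d" using dense by blast
    then have "\<forall>\<^sub>F T in sequentially. real (card ({i. x i \<noteq> y i} \<inter> {..<T})) \<le> d' * real T"
      using * by blast
    with eventually_gt_at_top[of 0] show "\<forall>\<^sub>F n in sequentially. ?f n < d"
    proof eventually_elim
      case (elim n)
      then have "?f n \<le> d'" by (simp only: card) (simp add: field_simps)
      then show ?case using d' by linarith
    qed
  qed
  finally show ?thesis .
qed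

lemma dbar_less_eventually:
  assumes "dbar x y < e"
  shows "\<forall>\<^sub>F T in sequentially. real (card ({i. x i \<noteq> y i} \<inter> {..<T})) \<le> e * real T"
  using dbar_le_iff[of x y "dbar x y"] assms unfolding upper_density_le_def by simp

lemma dbar_triangle: "dbar x z \<le> dbar x y + dbar y z"
proof -
  have "upper_density_le ({i. x i \<noteq> y i} \<union> {i. y i \<noteq> z i}) (dbar x y + dbar y z)"
    by (intro upper_density_le_Un dbar_le_iff[THEN iffD1] order_refl)
  then show ?thesis
    unfolding dbar_le_iff by (rule upper_density_le_mono) auto
qed

lemma dbar_commute: "dbar x y = dbar y x"
proof -
  have "{i \<in> {0..<n}. x i \<noteq> y i} = {i \<in> {0..<n}. y i \<noteq> x i}" for n by auto
  then show ?thesis by (simp only: dbar_def)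
qed

lemma dbar_nonneg: "0 \<le> dbar x y"
proof (rule ccontr)
  assume "\<not> 0 \<le> dbar x y"
  then have "\<forall>\<^sub>F T in sequentially. real (card ({i. x i \<noteq> y i} \<inter> {..<T})) \<le> (dbar x y / 2) * real T"
    by (intro dbar_less_eventually) auto
  with eventually_gt_at_top[of 0] have "\<forall>\<^sub>F T in sequentially. False"
  proof eventually_elim
    case (elim T)
    have "(dbar x y / 2) * real T < 0" using elim \<open>\<not> 0 \<le> dbar x y\<close> by (simp add: mult_neg_pos)
    then show ?case using elim by (smt (verit) of_nat_0_le_iff)
  qed
  then show False by simp
qed

lemma dbar_eq_0_iff: "dbar x y = 0 \<longleftrightarrow> upper_density_le {i. x i \<noteq> y i} 0"
  using dbar_le_iff[of x y 0] dbar_nonneg[of x y] by auto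

section \<open>Points, windows and the language\<close>

lemma funpow_shift: "(shift ^^ n) x = (\<lambda>i. x (n + i))"
  by (induction n) (simp_all add: shift_def)

lemma rho_less_1_imp: "rho x y < 1 \<Longrightarrow> x 0 = y 0"
proof (rule ccontr)
  assume "rho x y < 1" "x 0 \<noteq> y 0"
  then have "(LEAST n. x n \<noteq> y n) = 0" "x \<noteq> y" by (auto intro: Least_equality)
  then have "rho x y = 1" unfolding rho_def by (simp only: if_False power_0 div_by_1)
  then show False using \<open>rho x y < 1\<close> by simp
qed

lemma rho_le_if_agree:
  assumes "\<And>j. j < K \<Longrightarrow> x j = y j"
  shows "rho x y \<le> 1 / 2 ^ K"
proof (cases "x = y")
  case False
  then obtain n where "x n \<noteq> y n" by blast
  then have "x (LEAST n. x n \<noteq> y n) \<noteq> y (LEAST n. x n \<noteq> y n)" by (rule LeastI)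
  then have "K \<le> (LEAST n. x n \<noteq> y n)" using assms[of "LEAST n. x n \<noteq> y n"] by linarith
  then have "1 / 2 ^ (LEAST n. x n \<noteq> y n) \<le> (1 / 2 ^ K :: real)"
    by (intro divide_left_mono power_increasing) auto
  then show ?thesis using False unfolding rho_def by (simp only: if_False)
qed (simp add: rho_def)

text \<open>Membership of a window of \<open>f\<close> in the language, with a witness point in
  place of a list; \<open>map_in_language_iff\<close> translates.\<close>

definition admissible :: "binseq set \<Rightarrow> binseq \<Rightarrow> nat \<Rightarrow> nat \<Rightarrow> bool" where
  "admissible X f i K \<longleftrightarrow> (\<exists>x\<in>X. \<forall>j<K. x j = f (i + j))"

text \<open>Up to density zero these are the zeroth-symbol sequences of vague pseudo-orbits.\<close>

definition asymp_admissible :: "binseq set \<Rightarrow> binseq \<Rightarrow> bool" where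
  "asymp_admissible X f \<longleftrightarrow> (\<forall>K. upper_density_le {i. \<not> admissible X f i K} 0)"

lemma language_iff: "w \<in> language X \<longleftrightarrow> (\<exists>x\<in>X. \<forall>j<length w. x j = w ! j)"
proof -
  have "map x [0..<length w] = w \<longleftrightarrow> (\<forall>j<length w. x j = w ! j)" for x :: binseq
    by (subst list_eq_iff_nth_eq) (simp only: length_map length_upt nth_map_upt, simp)
  then show ?thesis unfolding language_def mem_Collect_eq by (simp only:)
qed

lemma map_in_language_iff: "map f [i..<i + K] \<in> language X \<longleftrightarrow> admissible X f i K"
  by (simp add: language_iff admissible_def)

lemma shift_space_closed_shift:
  assumes "shift_space X" "x \<in> X"
  shows "(\<lambda>i. x (n + i)) \<in> X"
proof -
  have "(shift ^^ n) x \<in> X"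
    using assms by (induction n) (auto simp: shift_space_def)
  then show ?thesis by (simp add: funpow_shift)
qed

lemma admissible_sub:
  assumes "shift_space X" "admissible X f i K" "i \<le> i'" "i' + K' \<le> i + K"
  shows "admissible X f i' K'"
proof -
  from assms(2) obtain x where x: "x \<in> X" "\<And>j. j < K \<Longrightarrow> x j = f (i + j)"
    unfolding admissible_def by blast
  show ?thesis
    unfolding admissible_def
  proof (intro bexI allI impI)
    show "(\<lambda>j. x (i' - i + j)) \<in> X" using assms(1) x(1) by (rule shift_space_closed_shift)
    show "x (i' - i + j) = f (i' + j)" if "j < K'" for j
      using x(2)[of "i' - i + j"] that assms(3,4) by (simp add: algebra_simps)
  qed
qed

lemma admissible_point:
  assumes "shift_space X" "x \<in> X" "\<And>j. j < K \<Longrightarrow> f (i + j) = x (n + j)"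
  shows "admissible X f i K"
  unfolding admissible_def
proof (intro bexI allI impI)
  show "x (n + j) = f (i + j)" if "j < K" for j using assms(3)[OF that] by (rule sym)
qed (rule shift_space_closed_shift[OF assms(1,2)])

section \<open>Cuts and splicing along blocks\<close>

text \<open>A window of length \<open>K\<close> at \<open>i\<close> can fail only if a cut lies
  inside it, which puts \<open>i\<close> into one of \<open>K\<close> translates of
  \<open>B\<close>. The interval is open at \<open>i\<close> because a cut is the first position of
  a new piece, so a window may start there.\<close>

lemma asymp_admissible_if_cuts:
  assumes "upper_density_le B 0"
    and "\<And>i K. B \<inter> {i<..<i + K} = {} \<Longrightarrow> admissible X f i K"
  shows "asymp_admissible X f"
  unfolding asymp_admissible_def
proof
  fix K
  have "upper_density_le (\<Union>j<K. {i. i + j \<in> B}) 0"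
    by (rule upper_density_0_UN_less, rule upper_density_0_translate, rule assms(1))
  moreover have "{i. \<not> admissible X f i K} \<subseteq> (\<Union>j<K. {i. i + j \<in> B})"
  proof
    fix i assume "i \<in> {i. \<not> admissible X f i K}"
    then have "B \<inter> {i<..<i + K} \<noteq> {}" using assms(2)[of i K] by auto
    then obtain b where "b \<in> B" "i < b" "b < i + K" by auto
    then show "i \<in> (\<Union>j<K. {i. i + j \<in> B})"
      by (intro UN_I[of "b - i"]) auto
  qed
  ultimately show "upper_density_le {i. \<not> admissible X f i K} 0" by (rule upper_density_le_mono)
qed

text \<open>For \<open>t\<close> strictly increasing from 0 this is the \<open>n\<close> with
  \<open>t n \<le> i < t (Suc n)\<close>; minimality supplies the lower bound.\<close>

definition block_index :: "(nat \<Rightarrow> nat) \<Rightarrow> nat \<Rightarrow> nat" where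
  "block_index t i = (LEAST n. i < t (Suc n))"

lemma block_index_eq:
  assumes "strict_mono t" "t n \<le> i" "i < t (Suc n)"
  shows "block_index t i = n"
  unfolding block_index_def
proof (rule Least_equality)
  fix m assume "i < t (Suc m)"
  with assms(2) have "t n < t (Suc m)" by simp
  then show "n \<le> m" using assms(1) by (simp add: strict_mono_less)
qed (rule assms(3))

lemma block_index_bounds:
  assumes "strict_mono t" "t 0 = 0"
  shows "t (block_index t i) \<le> i" "i < t (Suc (block_index t i))"
proof -
  have "i < t (Suc i)" using strict_mono_imp_increasing[OF assms(1), of "Suc i"] by simp
  then show "i < t (Suc (block_index t i))" unfolding block_index_def by (rule LeastI)
  show "t (block_index t i) \<le> i"
  proof (cases "block_index t i")
    case (Suc m)
    then have "\<not> i < t (Suc m)"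
      using not_less_Least[of m "\<lambda>n. i < t (Suc n)"] by (simp add: block_index_def)
    then show ?thesis using Suc by simp
  qed (simp add: assms(2))
qed

lemma admissible_within_blocks:
  assumes "shift_space X" "strict_mono t" "t 0 = 0"
    and "\<And>n. admissible X f (t n) (t (Suc n) - t n)"
    and "range t \<inter> {i<..<i + K} = {}"
  shows "admissible X f i K"
proof -
  define n where "n = block_index t i"
  have n: "t n \<le> i" "i < t (Suc n)" using block_index_bounds[OF assms(2,3)] by (auto simp: n_def)
  have "i + K \<le> t (Suc n)" 
  proof (rule ccontr)
    assume "\<not> i + K \<le> t (Suc n)"
    then have "t (Suc n) \<in> range t \<inter> {i<..<i + K}" using n by simp
    then show False using assms(5) by simp
  qed
  then show ?thesis
    using n by (intro admissible_sub[OF assms(1) assms(4)[of n]]) auto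
qed

lemma upper_density_0_range_gaps:
  assumes "strict_mono t" "\<And>M. \<exists>n0. \<forall>n\<ge>n0. t n + M \<le> t (Suc n)"
  shows "upper_density_le (range t) 0"
proof (rule upper_density_0_sparse)
  fix M
  obtain n0 where n0: "\<And>n. n \<ge> n0 \<Longrightarrow> t n + M \<le> t (Suc n)" using assms(2) by blast
  have "t m + M \<le> t n" if "t n0 \<le> t m" "t m < t n" for m n
  proof -
    have "n0 \<le> m" "Suc m \<le> n" using that assms(1) by (auto simp: strict_mono_less strict_mono_less_eq)
    then have "t m + M \<le> t (Suc m)" "t (Suc m) \<le> t n"
      using n0 assms(1) by (auto simp: strict_mono_less_eq)
    then show ?thesis by simp
  qed
  then show "\<exists>N. \<forall>x\<in>range t. \<forall>y\<in>range t. N \<le> x \<and> x < y \<longrightarrow> x + M \<le> y"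
    by (intro exI[of _ "t n0"]) auto
qed

text \<open>The splicing tool: pieces of points placed on blocks whose lengths tend to infinity give
  a sequence to which traceability applies.\<close>

lemma asymp_admissible_blocks:
  assumes "shift_space X" "strict_mono t" "t 0 = 0"
    and "\<And>n. admissible X f (t n) (t (Suc n) - t n)"
    and "\<And>M. \<exists>n0. \<forall>n\<ge>n0. t n + M \<le> t (Suc n)"
  shows "asymp_admissible X f"
  using upper_density_0_range_gaps[OF assms(2,5)] admissible_within_blocks[OF assms(1-4)]
  by (rule asymp_admissible_if_cuts)

lemma infinite_concat_block:
  assumes "\<And>i. w i \<noteq> []" "j < length (w k)"
  shows "infinite_concat w (length (concat (map w [0..<k])) + j) = w k ! j"
proof -
  let ?c = "\<lambda>k. concat (map w [0..<k])"
  have "infinite_concat w (length (?c k) + j) = map (infinite_concat w) [0..<length (?c (Suc k))] ! (length (?c k) + j)"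
    using assms(2) by (subst nth_map) auto
  also have "\<dots> = ?c (Suc k) ! (length (?c k) + j)"
    using infinite_concat_prefix[of w "Suc k", OF assms(1)] by simp
  also have "\<dots> = (?c k @ w k) ! (length (?c k) + j)" by simp
  also have "\<dots> = w k ! j" by (rule nth_append_length_plus)
  finally show ?thesis .
qed

section \<open>Neighbourhoods of the orbit set in the space of sequences of points\<close>

lemma topspace_seq_topology: "topspace (seq_topology X) = {ys. \<forall>n. ys n \<in> X}"
  by (auto simp: seq_topology_def)

lemma continuous_map_seq_topology_entry:
  "continuous_map (seq_topology X) euclidean (\<lambda>ys. ys i j)"
proof -
  have "continuous_map (seq_topology X) (top_of_set X) (\<lambda>ys. ys i)"
    unfolding seq_topology_def by (rule continuous_map_product_projection) simp
  moreover have "continuous_map (top_of_set X) euclidean (\<lambda>x. x j)"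
    unfolding continuous_map_iff_continuous
    by (intro continuous_on_subset[OF continuous_on_product_coordinates]) simp
  ultimately have "continuous_map (seq_topology X) euclidean ((\<lambda>x. x j) \<circ> (\<lambda>ys. ys i))"
    by (rule continuous_map_compose)
  then show ?thesis by (simp add: comp_def)
qed

lemma openin_seq_topology_entry:
  "openin (seq_topology X) {ys \<in> topspace (seq_topology X). ys i j = b}"
  using openin_continuous_map_preimage[OF continuous_map_seq_topology_entry, of "{b}" X i j]
  by (simp add: open_discrete)

text \<open>Symbols are discrete, so a relation between two entries is a union of conditions that
  fix both. Equality and inequality of entries are therefore both open.\<close>

lemma openin_seq_topology_entries:
  "openin (seq_topology X) {ys \<in> topspace (seq_topology X). P (ys i j) (ys k l)}"
proof -
  let ?E = "\<lambda>i j b. {ys \<in> topspace (seq_topology X). ys i j = b}"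
  have "{ys \<in> topspace (seq_topology X). P (ys i j) (ys k l)} =
    (\<Union>(b, c) \<in> {(b, c). P b c}. ?E i j b \<inter> ?E k l c)"
    by auto
  also have "openin (seq_topology X) \<dots>"
    by (intro openin_Union) (auto intro!: openin_Int openin_seq_topology_entry)
  finally show ?thesis .
qed

lemma compact_UNIV_binseq: "compact (UNIV :: binseq set)"
proof -
  have "compact_space (product_topology (\<lambda>_::nat. euclidean :: bool topology) UNIV)"
    by (subst compact_space_product_topology) (simp add: compact_space_def finite_imp_compact)
  then show ?thesis by (simp add: euclidean_product_topology compact_space_def)
qed

lemma compact_space_seq_topology:
  assumes "closed X"
  shows "compact_space (seq_topology X)"
proof -
  have "compact X" using compact_Int_closed[OF compact_UNIV_binseq assms] by simp
  then show ?thesis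
    by (simp add: seq_topology_def compact_space_product_topology compact_space_subtopology)
qed

text \<open>Compactness turns a neighbourhood of the orbit set into a finite condition. The sets
  \<open>C K\<close> of sequences outside \<open>U\<close> that look like an orbit on the first
  \<open>K\<close> by \<open>K\<close> entries are closed and decreasing, and a common element would
  be an orbit; so some \<open>C K\<close> is empty.\<close>

lemma orbit_set_neighbourhood:
  assumes "closed X" "openin (seq_topology X) U" "orbit_set X \<subseteq> U"
  obtains K where "\<And>ys. (\<And>n. ys n \<in> X) \<Longrightarrow> (\<And>i j. i < K \<Longrightarrow> j < K \<Longrightarrow> ys i j = ys 0 (i + j)) \<Longrightarrow> ys \<in> U"
proof -
  define C where "C K = {ys \<in> topspace (seq_topology X). \<forall>i<K. \<forall>j<K. ys i j = ys 0 (i + j)} - U" for K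
  have closed_eq: "closedin (seq_topology X) {ys \<in> topspace (seq_topology X). ys i j = ys 0 (i + j)}" for i j
  proof -
    have "openin (seq_topology X) {ys \<in> topspace (seq_topology X). ys i j \<noteq> ys 0 (i + j)}"
      by (rule openin_seq_topology_entries)
    moreover have "topspace (seq_topology X) - {ys \<in> topspace (seq_topology X). ys i j = ys 0 (i + j)}
        = {ys \<in> topspace (seq_topology X). ys i j \<noteq> ys 0 (i + j)}" by blast
    ultimately show ?thesis by (auto simp: closedin_def)
  qed
  have closed: "closedin (seq_topology X) (C K)" for K
  proof -
    have "C K = (topspace (seq_topology X) - U) \<inter>
      (\<Inter>(i, j) \<in> {..<K} \<times> {..<K}. {ys \<in> topspace (seq_topology X). ys i j = ys 0 (i + j)})" if "K > 0"
      using that by (auto simp: C_def)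
    \<comment> \<open>\<open>K = 0\<close> is separate because \<open>closedin_Inter\<close> asks
      for a nonempty family.\<close>
    moreover have "C 0 = topspace (seq_topology X) - U" by (auto simp: C_def)
    moreover have "closedin (seq_topology X) (topspace (seq_topology X) - U)"
      using assms(2) by (rule closedin_diff[OF closedin_topspace])
    moreover have "closedin (seq_topology X) (\<Inter>(i, j) \<in> {..<K} \<times> {..<K}. 
        {ys \<in> topspace (seq_topology X). ys i j = ys 0 (i + j)})" if "K > 0"
      using that by (intro closedin_Inter) (auto intro: closed_eq)
    ultimately show ?thesis by (cases "K = 0") (auto intro: closedin_Int)
  qed
  have "decseq C" by (rule decseq_SucI) (auto simp: C_def)
  have "(\<Inter>K. C K) = {}"
  proof (rule equals0I)
    fix ys assume "ys \<in> (\<Inter>K. C K)"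
    then have ys: "ys \<in> C K" for K by blast
    have "ys i j = ys 0 (i + j)" for i j
      using ys[of "Suc (max i j)"] by (auto simp: C_def)
    then have "ys = (\<lambda>n. (shift ^^ n) (ys 0))" by (simp add: fun_eq_iff funpow_shift)
    moreover have "ys 0 \<in> X" using ys[of 0] by (auto simp: C_def topspace_seq_topology)
    ultimately have "ys \<in> orbit_set X" unfolding orbit_set_def by blast
    then show False using assms(3) ys[of 0] by (auto simp: C_def)
  qed
  then obtain K where "C K = {}"
    using compact_space_imp_nest[OF compact_space_seq_topology[OF assms(1)] closed _ \<open>decseq C\<close>] by blast
  show ?thesis
  proof
    fix ys assume "\<And>n. ys n \<in> X" "\<And>i j. i < K \<Longrightarrow> j < K \<Longrightarrow> ys i j = ys 0 (i + j)"
    then show "ys \<in> U" using \<open>C K = {}\<close> by (auto simp: C_def topspace_seq_topology)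
  qed
qed

section \<open>Vague specification as traceability of symbol sequences\<close>

text \<open>Vague specification freed from sequences of points and their topology; both directions
  of the theorem pass through it.\<close>

definition traceable :: "binseq set \<Rightarrow> bool" where
  "traceable X \<longleftrightarrow> (\<forall>f. asymp_admissible X f \<longrightarrow> (\<exists>z\<in>X. dbar z f = 0))"

text \<open>A point that follows the longest admissible window at \<open>n\<close> follows the
  shorter ones too. The cap \<open>K \<le> n\<close> makes a longest one exist, yet excludes only
  finitely many \<open>n\<close> for each fixed \<open>K\<close>.\<close>

lemma ex_admissible_approximation:
  assumes "shift_space X"
  shows "\<exists>x\<in>X. \<forall>K\<le>n. admissible X f n K \<longrightarrow> (\<forall>j<K. x j = f (n + j))"
proof -
  define K where "K = Max {K. K \<le> n \<and> admissible X f n K}"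
  have fin: "finite {K. K \<le> n \<and> admissible X f n K}" by simp
  have "admissible X f n 0" using assms by (auto simp: admissible_def shift_space_def)
  then have "K \<in> {K. K \<le> n \<and> admissible X f n K}"
    unfolding K_def by (intro Max_in fin) auto
  then obtain x where "x \<in> X" "\<And>j. j < K \<Longrightarrow> x j = f (n + j)" by (auto simp: admissible_def)
  moreover have "K' \<le> K" if "K' \<le> n" "admissible X f n K'" for K'
    unfolding K_def using that by (intro Max_ge fin) simp
  ultimately show ?thesis by (meson less_le_trans)
qed

text \<open>The points \<open>xs n\<close> follow \<open>f\<close> from position \<open>n\<close> as
  far as possible. They form a vague pseudo-orbit whose zeroth symbols are \<open>f\<close> outside
  density zero, so a point that traces \<open>xs\<close> traces \<open>f\<close>.\<close>

lemma traceable_if_vague_specification: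
  assumes X: "shift_space X" and spec: "vague_specification X"
  shows "traceable X"
  unfolding traceable_def
proof (intro allI impI)
  fix f assume f: "asymp_admissible X f"
  have "\<forall>n. \<exists>x. x \<in> X \<and> (\<forall>K\<le>n. admissible X f n K \<longrightarrow> (\<forall>j<K. x j = f (n + j)))"
    using ex_admissible_approximation[OF X] by blast
  then obtain xs where xs: "\<And>n. xs n \<in> X"
    "\<And>n K j. K \<le> n \<Longrightarrow> admissible X f n K \<Longrightarrow> j < K \<Longrightarrow> xs n j = f (n + j)"
    by metis
  have bad: "upper_density_le ({..<K} \<union> {n. \<not> admissible X f n K}) 0" for K
    using f by (intro upper_density_0_Un) (auto simp: asymp_admissible_def upper_density_0_finite)
  have "vague_pseudo_orbit X xs"
    unfolding vague_pseudo_orbit_def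
  proof (intro conjI allI impI)
    fix U assume "openin (seq_topology X) U \<and> orbit_set X \<subseteq> U"
    moreover have "closed X" using X by (simp add: shift_space_def)
    ultimately obtain K where K: "\<And>ys. (\<And>n. ys n \<in> X) \<Longrightarrow>
        (\<And>i j. i < K \<Longrightarrow> j < K \<Longrightarrow> ys i j = ys 0 (i + j)) \<Longrightarrow> ys \<in> U"
      using orbit_set_neighbourhood by metis
    \<comment> \<open>A window of length \<open>3 * K\<close> at \<open>n\<close> contains the
      windows of length \<open>2 * K\<close> at \<open>n + i\<close> for \<open>i < K\<close>, so
      \<open>xs n\<close> and \<open>xs (n + i)\<close> both read off \<open>f\<close> and
      agree.\<close>
    have "(shift ^^ n) xs \<in> U" if n: "3 * K \<le> n" "admissible X f n (3 * K)" for n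
    proof (rule K)
      fix i j assume ij: "i < K" "j < K"
      have "admissible X f (n + i) (2 * K)"
        by (rule admissible_sub[OF X n(2)]) (use ij in auto)
      then have "xs (n + i) j = f (n + i + j)" using ij n by (intro xs(2)[of "2 * K"]) auto
      moreover have "xs n (i + j) = f (n + (i + j))" using ij n by (intro xs(2)[of "3 * K"]) auto
      ultimately show "(shift ^^ n) xs i j = (shift ^^ n) xs 0 (i + j)"
        by (simp add: funpow_shift add.assoc)
    qed (simp add: funpow_shift xs(1))
    then have "- {n. (shift ^^ n) xs \<in> U} \<subseteq> {..<3 * K} \<union> {n. \<not> admissible X f n (3 * K)}"
      by (auto simp: not_less)
    then show "density_one {n. (shift ^^ n) xs \<in> U}"
      unfolding density_one_iff by (rule upper_density_le_mono[OF bad])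
  qed (rule xs(1))
  then obtain z where z: "z \<in> X" "\<And>\<epsilon>. \<epsilon> > 0 \<Longrightarrow> density_one {n. rho ((shift ^^ n) z) (xs n) < \<epsilon>}"
    using spec unfolding vague_specification_def by blast
  have "{n. z n \<noteq> f n} \<subseteq> - {n. rho ((shift ^^ n) z) (xs n) < 1} \<union> ({..<1} \<union> {n. \<not> admissible X f n 1})"
  proof (rule subsetI, rule ccontr)
    fix n assume n: "n \<in> {n. z n \<noteq> f n}" 
      "n \<notin> - {n. rho ((shift ^^ n) z) (xs n) < 1} \<union> ({..<1} \<union> {n. \<not> admissible X f n 1})"
    then have "z n = xs n 0"
      using rho_less_1_imp[of "(shift ^^ n) z" "xs n"] by (simp add: funpow_shift)
    moreover have "xs n 0 = f (n + 0)" using n(2) by (intro xs(2)[of 1]) auto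
    ultimately show False using n(1) by simp
  qed
  moreover have "upper_density_le (- {n. rho ((shift ^^ n) z) (xs n) < 1} \<union> ({..<1} \<union> {n. \<not> admissible X f n 1})) 0"
    using z(2)[of 1] by (intro upper_density_0_Un[OF _ bad[of 1]]) (simp add: density_one_iff)
  ultimately have "dbar z f = 0" unfolding dbar_eq_0_iff by (rule upper_density_le_mono[rotated])
  then show "\<exists>z\<in>X. dbar z f = 0" using z(1) by blast
qed

text \<open>The zeroth symbols \<open>f\<close> of \<open>xs\<close> are traced. Outside density
  zero, any fixed number of initial symbols of \<open>xs n\<close> agrees with \<open>f\<close> from
  \<open>n\<close> on, so closeness to \<open>f\<close> passes to \<open>xs\<close>.\<close>

lemma vague_specification_if_traceable:
  assumes X: "shift_space X" and "traceable X"
  shows "vague_specification X"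
  unfolding vague_specification_def
proof (intro allI impI)
  fix xs assume vpo: "vague_pseudo_orbit X xs"
  define f where "f n = xs n 0" for n
  have xs: "xs n \<in> X" for n using vpo by (simp add: vague_pseudo_orbit_def)
  have step: "upper_density_le {n. xs (Suc n) j \<noteq> xs n (Suc j)} 0" for j
  proof -
    \<comment> \<open>Every orbit satisfies this relation between its first two points, so
      \<open>?U\<close> is a neighbourhood of the orbit set to test with.\<close>
    let ?U = "{ys \<in> topspace (seq_topology X). ys 1 j = ys 0 (Suc j)}"
    have "openin (seq_topology X) ?U" by (rule openin_seq_topology_entries)
    moreover have "orbit_set X \<subseteq> ?U"
      using shift_space_closed_shift[OF X]
      by (auto simp: orbit_set_def topspace_seq_topology funpow_shift)
    ultimately have "density_one {n. (shift ^^ n) xs \<in> ?U}"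
      using vpo unfolding vague_pseudo_orbit_def by blast
    then show ?thesis
      unfolding density_one_iff
      by (rule upper_density_le_mono) (auto simp: topspace_seq_topology funpow_shift)
  qed
  have entry: "upper_density_le {n. xs n j \<noteq> f (n + j)} 0" for j
  proof (induction j)
    case (Suc j)
    \<comment> \<open>Outside density zero, symbol \<open>Suc j\<close> of \<open>xs n\<close> is
      symbol \<open>j\<close> of \<open>xs (Suc n)\<close>, which the induction hypothesis compares
      with \<open>f\<close>; hence the translate by 1.\<close>
    have "upper_density_le ({n. xs (Suc n) j \<noteq> xs n (Suc j)} \<union> {n. n + 1 \<in> {n. xs n j \<noteq> f (n + j)}}) 0"
      by (rule upper_density_0_Un[OF step upper_density_0_translate[OF Suc]])
    then show ?case by (rule upper_density_le_mono) auto
  qed (simp add: f_def upper_density_0_finite)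
  have prefix: "upper_density_le (\<Union>j<K. {n. xs n j \<noteq> f (n + j)}) 0" for K
    by (rule upper_density_0_UN_less) (rule entry)
  have "asymp_admissible X f"
    unfolding asymp_admissible_def
  proof
    fix K
    have "{i. \<not> admissible X f i K} \<subseteq> (\<Union>j<K. {n. xs n j \<noteq> f (n + j)})"
      using xs by (auto simp: admissible_def)
    then show "upper_density_le {i. \<not> admissible X f i K} 0" by (rule upper_density_le_mono[OF prefix])
  qed
  then obtain z where z: "z \<in> X" "dbar z f = 0" using assms(2) unfolding traceable_def by blast
  have "density_one {n. rho ((shift ^^ n) z) (xs n) < \<epsilon>}" if "\<epsilon> > 0" for \<epsilon>
  proof -
    obtain K where K: "1 / 2 ^ K < \<epsilon>"
      using real_arch_pow_inv[OF \<open>\<epsilon> > 0\<close>, of "1 / 2"] unfolding power_one_over by auto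
    \<comment> \<open>Closeness follows from agreement in \<open>K\<close> symbols, each compared
      through \<open>f\<close>: \<open>z\<close> with \<open>f\<close> at \<open>n + j\<close>, and
      \<open>f\<close> at \<open>n + j\<close> with \<open>xs n\<close> at \<open>j\<close>.\<close>
    let ?B = "(\<Union>j<K. {n. n + j \<in> {i. z i \<noteq> f i}}) \<union> (\<Union>j<K. {n. xs n j \<noteq> f (n + j)})"
    have "upper_density_le (\<Union>j<K. {n. n + j \<in> {i. z i \<noteq> f i}}) 0"
      by (rule upper_density_0_UN_less, rule upper_density_0_translate) (use z(2) in \<open>simp only: dbar_eq_0_iff\<close>)
    then have "upper_density_le ?B 0" using prefix by (rule upper_density_0_Un)
    moreover have "- {n. rho ((shift ^^ n) z) (xs n) < \<epsilon>} \<subseteq> ?B"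
    proof (rule subsetI, rule ccontr)
      fix n assume n: "n \<in> - {n. rho ((shift ^^ n) z) (xs n) < \<epsilon>}" "n \<notin> ?B"
      then have "(shift ^^ n) z j = xs n j" if "j < K" for j
        using that by (auto simp: funpow_shift)
      then have "rho ((shift ^^ n) z) (xs n) \<le> 1 / 2 ^ K" by (rule rho_le_if_agree)
      then show False using n(1) K by simp
    qed
    ultimately show ?thesis unfolding density_one_iff by (rule upper_density_le_mono)
  qed
  then show "\<exists>z\<in>X. \<forall>\<epsilon>>0. density_one {n. rho ((shift ^^ n) z) (xs n) < \<epsilon>}" using z(1) by blast
qed

lemma vague_specification_iff_traceable:
  "shift_space X \<Longrightarrow> vague_specification X \<longleftrightarrow> traceable X"
  using traceable_if_vague_specification vague_specification_if_traceable by blast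

section \<open>Completeness and shadowing imply traceability\<close>

lemma upper_density_0_translate_right:
  assumes "upper_density_le A 0"
  shows "upper_density_le {n. j \<le> n \<and> n - j \<in> A} 0"
  unfolding upper_density_le_def
proof (intro allI impI)
  fix d :: real assume "0 < d"
  then have "\<forall>\<^sub>F T in sequentially. real (card (A \<inter> {..<T})) \<le> d * real T"
    using assms unfolding upper_density_le_def by blast
  then show "\<forall>\<^sub>F T in sequentially. real (card ({n. j \<le> n \<and> n - j \<in> A} \<inter> {..<T})) \<le> d * real T"
  proof eventually_elim
    case (elim T)
    have "card ({n. j \<le> n \<and> n - j \<in> A} \<inter> {..<T}) \<le> card (A \<inter> {..<T})"
      by (rule card_inj_on_le[where f = "\<lambda>n. n - j"]) (auto simp: inj_on_def)
    then show ?case using elim by linarith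
  qed
qed

lemma dbar_approximation_if_shadowing:
  assumes X: "shift_space X" and "dbar_shadowing X" and f: "asymp_admissible X f" and "0 < e"
  shows "\<exists>x\<in>X. dbar x f < e"
proof -
  obtain N where N: "1 \<le> N" "\<And>w. (\<And>i. w i \<in> language X \<and> N \<le> length (w i)) \<Longrightarrow>
      \<exists>x\<in>X. dbar x (infinite_concat w) < e"
    using assms(2,4) unfolding dbar_shadowing_def by blast
  obtain p where p: "p \<in> X" using X by (auto simp: shift_space_def)
  \<comment> \<open>An inadmissible block is replaced by a prefix of \<open>p\<close>; the form
    \<open>0 + N\<close> fits \<open>map_in_language_iff\<close>.\<close>
  define w where "w k = (if admissible X f (k * N) N then map f [k * N..<k * N + N] else map p [0..<0 + N])" for k
  have "admissible X p 0 N" using p by (auto simp: admissible_def)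
  then have lang: "w k \<in> language X" for k
    by (auto simp only: w_def map_in_language_iff split: if_splits)
  have len: "length (w k) = N" for k by (simp add: w_def)
  then have ne: "w k \<noteq> []" for k using N(1) by (metis list.size(3) not_one_le_zero)
  define g where "g = infinite_concat w"
  obtain x where x: "x \<in> X" "dbar x g < e"
    using N(2)[of w] lang len unfolding g_def by (metis order_refl)
  have concat: "length (concat (map w [0..<k])) = k * N" for k
    by (induction k) (simp_all add: len)
  have g: "g (k * N + j) = w k ! j" if "j < N" for k j
    using infinite_concat_block[of w j k, OF ne] that by (simp only: len concat g_def)
  \<comment> \<open>The \<open>N\<close>-block containing \<open>i\<close> lies in the window of
    length \<open>2 * N\<close> at \<open>i - N\<close>. A mismatch forces that window to be
    inadmissible, so the mismatches lie in a translated set of density zero.\<close>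
  have "{i. g i \<noteq> f i} \<subseteq> {..<N} \<union> {i. N \<le> i \<and> i - N \<in> {i. \<not> admissible X f i (2 * N)}}"
  proof (rule subsetI, rule ccontr)
    fix i assume i: "i \<in> {i. g i \<noteq> f i}" "i \<notin> {..<N} \<union> {i. N \<le> i \<and> i - N \<in> {i. \<not> admissible X f i (2 * N)}}"
    define k j where "k = i div N" and "j = i mod N"
    have kj: "i = k * N + j" unfolding k_def j_def by (rule div_mult_mod_eq[symmetric])
    have "j < N" using N(1) unfolding j_def by (intro mod_less_divisor) linarith
    have "N \<le> i" "admissible X f (i - N) (2 * N)" using i(2) by auto
    moreover from this have "i - N \<le> k * N" "k * N + N \<le> i - N + 2 * N" 
      using kj \<open>j < N\<close> by linarith+
    ultimately have "admissible X f (k * N) N"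
      using admissible_sub[OF X, of f "i - N" "2 * N"] by blast
    then have "g i = f i" using g[OF \<open>j < N\<close>, of k] \<open>j < N\<close> unfolding kj w_def by simp
    then show False using i(1) by simp
  qed
  moreover have "upper_density_le ({..<N} \<union> {i. N \<le> i \<and> i - N \<in> {i. \<not> admissible X f i (2 * N)}}) 0"
    using f unfolding asymp_admissible_def by (intro upper_density_0_Un upper_density_0_translate_right) (simp_all add: upper_density_0_finite)
  ultimately have "dbar g f = 0" unfolding dbar_eq_0_iff by (rule upper_density_le_mono[rotated])
  then have "dbar x f < e" using dbar_triangle[of x f g] x(2) by linarith
  then show ?thesis using x(1) by blast
qed

text \<open>Points of \<open>X\<close> within \<open>1 / (n + 1)\<close> of \<open>f\<close> form a
  Cauchy sequence although \<open>f\<close> itself may lie outside \<open>X\<close>; completeness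
  yields a limit in \<open>X\<close>, and it has distance 0 from \<open>f\<close>.\<close>

lemma traceable_if_complete_shadowing:
  assumes X: "shift_space X" and complete: "dbar_complete X" and shadowing: "dbar_shadowing X"
  shows "traceable X"
  unfolding traceable_def
proof (intro allI impI)
  fix f assume f: "asymp_admissible X f"
  have "\<exists>x. x \<in> X \<and> dbar x f < 1 / real (Suc n)" for n
    using dbar_approximation_if_shadowing[OF X shadowing f, of "1 / real (Suc n)"] by auto
  then obtain z where z: "\<And>n. z n \<in> X" "\<And>n. dbar (z n) f < 1 / real (Suc n)" by metis
  have small: "\<exists>M. \<forall>n\<ge>M. dbar (z n) f < e" if "e > 0" for e
  proof -
    obtain M where M: "inverse (real (Suc M)) < e" using reals_Archimedean[OF \<open>e > 0\<close>] by blast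
    have "dbar (z n) f < e" if "M \<le> n" for n
    proof -
      have "1 / real (Suc n) \<le> inverse (real (Suc M))" using that by (simp add: field_simps)
      then show ?thesis using z(2)[of n] M by linarith
    qed
    then show ?thesis by blast
  qed
  have "\<exists>M. \<forall>m\<ge>M. \<forall>n\<ge>M. dbar (z m) (z n) < e" if "e > 0" for e
  proof -
    obtain M where M: "\<forall>n\<ge>M. dbar (z n) f < e / 2" using small[OF half_gt_zero[OF \<open>e > 0\<close>]] by (rule exE)
    have "dbar (z m) (z n) < e" if "m \<ge> M" "n \<ge> M" for m n
      using M[rule_format, OF that(1)] M[rule_format, OF that(2)] dbar_triangle[of "z m" "z n" f] dbar_commute[of f "z n"] by linarith
    then show ?thesis by blast
  qed
  then obtain z' where z': "z' \<in> X" "(\<lambda>n. dbar (z n) z') \<longlonglongrightarrow> 0"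
    using complete z(1) unfolding dbar_complete_def by blast
  have "dbar z' f \<le> 0 + e" if "e > 0" for e
  proof -
    obtain M where M: "\<forall>n\<ge>M. dbar (z n) f < e / 2" using small[OF half_gt_zero[OF \<open>e > 0\<close>]] by (rule exE)
    have "\<forall>\<^sub>F n in sequentially. dbar (z n) z' < e / 2"
      using order_tendstoD(2)[OF z'(2), of "e / 2"] that by simp
    then obtain n where "n \<ge> M" "dbar (z n) z' < e / 2"
      unfolding eventually_sequentially by (meson le_cases)
    then show ?thesis
      using M[rule_format, of n] dbar_triangle[of z' f "z n"] dbar_commute[of z' "z n"] by linarith
  qed
  then have "dbar z' f \<le> 0" by (rule field_le_epsilon)
  then have "dbar z' f = 0" using dbar_nonneg[of z' f] by linarith
  then show "\<exists>z\<in>X. dbar z f = 0" using z'(1) by blast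
qed

section \<open>Traceability implies completeness\<close>

text \<open>Terms \<open>y m\<close> are selected with \<open>dbar (y n) (y m) < 1 / 2 ^ m\<close>
  for \<open>m \<le> n\<close>, and \<open>f\<close> follows \<open>y n\<close> on block
  \<open>n\<close>. Blocks that grow geometrically keep the mismatches of \<open>f\<close> with
  \<open>y m\<close> below density \<open>3 / 2 ^ m\<close>, up to a constant, so a point tracing
  \<open>f\<close> is the limit.\<close>

lemma dbar_complete_if_traceable:
  assumes X: "shift_space X" and traceable: "traceable X"
  shows "dbar_complete X"
  unfolding dbar_complete_def
proof (intro allI impI)
  fix z :: "nat \<Rightarrow> binseq"
  assume "(\<forall>n. z n \<in> X) \<and> (\<forall>\<epsilon>>0. \<exists>M. \<forall>m\<ge>M. \<forall>n\<ge>M. dbar (z m) (z n) < \<epsilon>)"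
  then have z: "\<And>n. z n \<in> X" and Cauchy: "\<And>\<epsilon>. \<epsilon> > 0 \<Longrightarrow> \<exists>M. \<forall>m\<ge>M. \<forall>n\<ge>M. dbar (z m) (z n) < \<epsilon>"
    by blast+
  have "\<exists>M. \<forall>m\<ge>M. \<forall>n\<ge>M. dbar (z m) (z n) < 1 / 2 ^ k" for k
    by (rule Cauchy) simp
  then obtain M where M: "\<And>k m n. M k \<le> m \<Longrightarrow> M k \<le> n \<Longrightarrow> dbar (z m) (z n) < 1 / 2 ^ k" by metis
  \<comment> \<open>The thresholds \<open>M\<close> may fail to be monotone; partial sums put
    \<open>r n\<close> beyond \<open>M m\<close> for every \<open>m \<le> n\<close>.\<close>
  define r where "r m = (\<Sum>i\<le>m. M i)" for m
  have r_ge: "M m \<le> r n" if "m \<le> n" for m n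
    unfolding r_def using that by (intro member_le_sum) auto
  define y where "y m = z (r m)" for m
  have y: "y m \<in> X" for m by (simp add: y_def z)
  define D where "D m n = {i. y n i \<noteq> y m i}" for m n
  have "\<forall>\<^sub>F T in sequentially. \<forall>m\<in>{..n}. real (card (D m n \<inter> {..<T})) \<le> 1 / 2 ^ m * real T" for n
  proof (intro eventually_ball_finite ballI)
    fix m assume "m \<in> {..n}"
    then have "dbar (y n) (y m) < 1 / 2 ^ m" unfolding y_def by (intro M r_ge) auto
    then show "\<forall>\<^sub>F T in sequentially. real (card (D m n \<inter> {..<T})) \<le> 1 / 2 ^ m * real T"
      unfolding D_def by (rule dbar_less_eventually)
  qed simp
  then have "\<exists>R. \<forall>T\<ge>R. \<forall>m\<in>{..n}. real (card (D m n \<inter> {..<T})) \<le> 1 / 2 ^ m * real T" for n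
    unfolding eventually_sequentially by blast
  then obtain R where R: "\<And>n T m. R n \<le> T \<Longrightarrow> m \<le> n \<Longrightarrow> real (card (D m n \<inter> {..<T})) \<le> 1 / 2 ^ m * real T"
    by (metis atMost_iff)
  \<comment> \<open>Doubling makes errors of earlier blocks sum geometrically, \<open>n + 1\<close>
    makes block lengths unbounded, and \<open>R (Suc n)\<close> makes the mismatch bounds for
    \<open>y (Suc n)\<close> valid from the start of its block.\<close>
  define t where "t = rec_nat 0 (\<lambda>n a. 2 * a + n + 1 + R (Suc n))"
  have t_0: "t 0 = 0" and t_Suc: "\<And>n. t (Suc n) = 2 * t n + n + 1 + R (Suc n)"
    by (simp_all add: t_def)
  have mono: "strict_mono t" by (rule strict_mono_Suc_iff[THEN iffD2]) (simp add: t_Suc)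
  have D_le: "real (card (D m n \<inter> {..<T})) \<le> 1 / 2 ^ m * real T" if "m \<le> n" "t n \<le> T" for m n T
  proof (cases n)
    \<comment> \<open>\<open>t 0\<close> is 0 and not controlled by \<open>R 0\<close>, but here
      \<open>m = 0\<close> and \<open>D 0 0\<close> is empty.\<close>
    case 0
    then show ?thesis using that by (simp add: D_def)
  next
    case (Suc n')
    then have "R n \<le> T" using that t_Suc[of n'] by simp
    then show ?thesis using R that by blast
  qed
  define f where "f i = y (block_index t i) i" for i
  have f: "f i = y n i" if "t n \<le> i" "i < t (Suc n)" for n i
    using block_index_eq[OF mono that] by (simp add: f_def)
  have "asymp_admissible X f"
  proof (rule asymp_admissible_blocks[OF X mono t_0])
    show "admissible X f (t n) (t (Suc n) - t n)" for n
      by (rule admissible_point[OF X y[of n], of _ _ _ "t n"]) (rule f, auto)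
    show "\<exists>n0. \<forall>n\<ge>n0. t n + M \<le> t (Suc n)" for M
      by (intro exI[of _ M]) (simp add: t_Suc)
  qed
  then obtain z' where z': "z' \<in> X" "dbar z' f = 0" using traceable unfolding traceable_def by blast
  define c where "c m T = card ({i. f i \<noteq> y m i} \<inter> {..<T})" for m T
  have c_step: "c m T \<le> c m (t n) + card (D m n \<inter> {..<T})" if "T \<le> t (Suc n)" for m n T
  proof -
    have "c m T \<le> card (({i. f i \<noteq> y m i} \<inter> {..<t n}) \<union> (D m n \<inter> {..<T}))"
      unfolding c_def
    proof (rule card_mono)
      show "{i. f i \<noteq> y m i} \<inter> {..<T} \<subseteq> {i. f i \<noteq> y m i} \<inter> {..<t n} \<union> D m n \<inter> {..<T}"
      proof
        fix i assume i: "i \<in> {i. f i \<noteq> y m i} \<inter> {..<T}"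
        show "i \<in> {i. f i \<noteq> y m i} \<inter> {..<t n} \<union> D m n \<inter> {..<T}"
        proof (cases "i < t n")
          case False
          then have "f i = y n i" using i that by (intro f) auto
          then show ?thesis using i by (auto simp: D_def)
        qed (use i in auto)
      qed
    qed simp
    also have "\<dots> \<le> c m (t n) + card (D m n \<inter> {..<T})" unfolding c_def by (rule card_Un_le)
    finally show ?thesis .
  qed
  \<comment> \<open>The factor 2 reproduces itself: \<open>2 * t n \<le> t (Suc n)\<close> reduces
    the earlier errors to \<open>1 / 2 ^ m * t (Suc n)\<close>, and the new block adds at most the
    same. An unfinished block later raises the factor to 3.\<close>
  have c_block: "real (c m (t n)) \<le> real (t m) + 2 / 2 ^ m * real (t n)" if "m \<le> n" for m n
    using that
  proof (induction n rule: dec_induct)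
    case base
    have "c m (t m) \<le> card {..<t m}" unfolding c_def by (intro card_mono) auto
    then have "real (c m (t m)) \<le> real (t m)" by simp
    moreover have "0 \<le> 2 / 2 ^ m * real (t m)" by simp
    ultimately show ?case by linarith
  next
    case (step n)
    have "real (c m (t (Suc n))) \<le> real (c m (t n)) + real (card (D m n \<inter> {..<t (Suc n)}))"
      using c_step[of "t (Suc n)" n m] by linarith
    also have "\<dots> \<le> real (t m) + 1 / 2 ^ m * real (2 * t n) + 1 / 2 ^ m * real (t (Suc n))"
      using step D_le[of m n "t (Suc n)"] by (simp add: t_Suc)
    also have "1 / 2 ^ m * real (2 * t n) \<le> 1 / 2 ^ m * real (t (Suc n))"
      by (intro mult_left_mono) (simp_all add: t_Suc)
    finally show ?case by simp
  qed
  have y_f: "dbar f (y m) \<le> 3 / 2 ^ m" for m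
    unfolding dbar_le_iff
  proof (rule upper_density_leI, intro exI allI)
    fix d :: real and T assume d: "3 / 2 ^ m < d"
    define n where "n = block_index t T"
    have n: "t n \<le> T" "T < t (Suc n)" using block_index_bounds[OF mono t_0] by (auto simp: n_def)
    have "real (c m T) \<le> 3 / 2 ^ m * real T + real (t m)"
    proof (cases "m \<le> n")
      case True
      have "real (c m T) \<le> real (c m (t n)) + real (card (D m n \<inter> {..<T}))"
        using c_step[of T n m] n by linarith
      also have "\<dots> \<le> (real (t m) + 2 / 2 ^ m * real (t n)) + 1 / 2 ^ m * real T"
        by (intro add_mono c_block D_le True n)
      also have "2 / 2 ^ m * real (t n) \<le> 2 / 2 ^ m * real T" by (intro mult_left_mono) (use n in auto)
      finally show ?thesis by (simp add: add_divide_distrib[symmetric] field_simps)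
    next
      case False
      then have "T \<le> t m" using n mono by (metis Suc_leI less_imp_le less_le_trans not_le strict_mono_less_eq)
      moreover have "c m T \<le> card {..<T}" unfolding c_def by (intro card_mono) auto
      ultimately have "real (c m T) \<le> real (t m)" by simp
      moreover have "0 \<le> 3 / 2 ^ m * real T" by simp
      ultimately show ?thesis by linarith
    qed
    also have "3 / 2 ^ m * real T \<le> d * real T" using d by (intro mult_right_mono) auto
    finally show "real (card ({i. f i \<noteq> y m i} \<inter> {..<T})) \<le> d * real T + real (t m)"
      unfolding c_def by simp
  qed
  have "(\<lambda>n. dbar (z n) z') \<longlonglongrightarrow> 0"
  proof (rule LIMSEQ_I)
    fix e :: real assume "0 < e"
    \<comment> \<open>Hence the quarter of \<open>e\<close>: one unit \<open>1 / 2 ^ m\<close> leads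
      from \<open>z n\<close> to \<open>y m\<close>, three more from \<open>y m\<close> to
      \<open>f\<close>.\<close>
    then obtain m where m: "(1 / 2) ^ m < e / 4" using real_arch_pow_inv[of "e / 4" "1 / 2"] by auto
    have "norm (dbar (z n) z' - 0) < e" if "r m \<le> n" for n
    proof -
      have "M m \<le> n" using r_ge[of m m] that by simp
      then have "dbar (z n) (y m) < 1 / 2 ^ m" unfolding y_def by (intro M r_ge) auto
      moreover have "dbar (z n) z' \<le> dbar (z n) (y m) + dbar (y m) f + dbar f z'"
        using dbar_triangle[of "z n" z' "y m"] dbar_triangle[of "y m" z' f] by linarith
      ultimately have "dbar (z n) z' < 1 / 2 ^ m + 3 / 2 ^ m"
        using y_f[of m] z'(2) dbar_commute[of "y m" f] dbar_commute[of f z'] by linarith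
      also have "\<dots> = 4 * (1 / 2) ^ m" by (simp add: power_one_over)
      also have "\<dots> < e" using m by simp
      finally show ?thesis using dbar_nonneg[of "z n" z'] by simp
    qed
    then show "\<exists>N. \<forall>n\<ge>N. norm (dbar (z n) z' - 0) < e" by blast
  qed
  then show "\<exists>z'\<in>X. (\<lambda>n. dbar (z n) z') \<longlonglongrightarrow> 0" using z'(1) by blast
qed

section \<open>Traceability implies shadowing\<close>

text \<open>Blocks between consecutive squares have lengths that tend to infinity, so splicing words over them is
  admissible, but that are negligible against their position, so a final incomplete block does not affect
  \<^const>\<open>dbar\<close>.\<close>

lemma dbar_tracing_of_close_square_blocks:
  assumes X: "shift_space X" and traceable: "traceable X" and "0 \<le> e"
    and close: "\<And>k. k0 \<le> k \<Longrightarrow> \<exists>x\<in>X. real (card {j. j < 2 * k + 1 \<and> g (k ^ 2 + j) \<noteq> x j}) \<le> e * real (2 * k + 1)"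
  shows "\<exists>z\<in>X. dbar z g \<le> e"
proof -
  have "X \<noteq> {}" using X by (simp add: shift_space_def)
  then have "\<exists>x. x \<in> X \<and> (k0 \<le> k \<longrightarrow> real (card {j. j < 2 * k + 1 \<and> g (k ^ 2 + j) \<noteq> x j}) \<le> e * real (2 * k + 1))" for k
    using close[of k] by blast
  then have "\<exists>x. \<forall>k. x k \<in> X \<and> (k0 \<le> k \<longrightarrow> real (card {j. j < 2 * k + 1 \<and> g (k ^ 2 + j) \<noteq> x k j}) \<le> e * real (2 * k + 1))"
    by (rule choice[OF allI])
  then obtain x where x: "\<And>k. x k \<in> X"
    "\<And>k. k0 \<le> k \<Longrightarrow> real (card {j. j < 2 * k + 1 \<and> g (k ^ 2 + j) \<noteq> x k j}) \<le> e * real (2 * k + 1)"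
    by blast
  define t where "t k = k ^ 2" for k :: nat
  have t_0: "t 0 = 0" and t_Suc: "\<And>k. t (Suc k) = t k + (2 * k + 1)"
    by (simp_all add: t_def power2_eq_square)
  have mono: "strict_mono t" by (rule strict_mono_Suc_iff[THEN iffD2]) (simp add: t_Suc)
  define f where "f i = x (block_index t i) (i - t (block_index t i))" for i
  have f: "f (t k + j) = x k j" if "j < 2 * k + 1" for k j
    using that block_index_eq[OF mono, of k "t k + j"] by (simp add: f_def t_Suc)
  have "asymp_admissible X f"
  proof (rule asymp_admissible_blocks[OF X mono t_0])
    show "admissible X f (t k) (t (Suc k) - t k)" for k
      by (rule admissible_point[OF X x(1)[of k], of _ _ _ 0]) (simp add: f t_Suc)
    show "\<exists>n0. \<forall>n\<ge>n0. t n + M \<le> t (Suc n)" for M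
      by (intro exI[of _ M]) (simp add: t_Suc)
  qed
  then obtain z where z: "z \<in> X" "dbar z f = 0" using traceable unfolding traceable_def by blast
  define c where "c T = card ({i. f i \<noteq> g i} \<inter> {..<T})" for T
  have c_mono: "c S \<le> c T" if "S \<le> T" for S T
    unfolding c_def using that by (intro card_mono) auto
  have c_block: "real (c (t k)) \<le> real (t k0) + e * real (t k)" if "k0 \<le> k" for k
    using that
  proof (induction k rule: dec_induct)
    case base
    have "c (t k0) \<le> card {..<t k0}" unfolding c_def by (intro card_mono) auto
    then have "real (c (t k0)) \<le> real (t k0)" by simp
    moreover have "0 \<le> e * real (t k0)" using \<open>0 \<le> e\<close> by simp
    ultimately show ?case by linarith
  next
    case (step k)
    let ?J = "{j. j < 2 * k + 1 \<and> g (k ^ 2 + j) \<noteq> x k j}"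
    have "{i. f i \<noteq> g i} \<inter> {..<t (Suc k)} \<subseteq> ({i. f i \<noteq> g i} \<inter> {..<t k}) \<union> (\<lambda>j. t k + j) ` ?J"
    proof
      fix i assume i: "i \<in> {i. f i \<noteq> g i} \<inter> {..<t (Suc k)}"
      show "i \<in> ({i. f i \<noteq> g i} \<inter> {..<t k}) \<union> (\<lambda>j. t k + j) ` ?J"
      proof (cases "i < t k")
        case False
        then have eq: "i = t k + (i - t k)" and less: "i - t k < 2 * k + 1" using i by (auto simp: t_Suc)
        have "f i = x k (i - t k)" using f[OF less] eq by simp
        moreover have "g i = g (k ^ 2 + (i - t k))" using eq by (simp add: t_def)
        ultimately have "i - t k \<in> ?J" using i less by auto
        then show ?thesis using eq by blast
      qed (use i in auto)
    qed
    then have "c (t (Suc k)) \<le> card (({i. f i \<noteq> g i} \<inter> {..<t k}) \<union> (\<lambda>j. t k + j) ` ?J)"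
      unfolding c_def by (intro card_mono) auto
    also have "\<dots> \<le> c (t k) + card ((\<lambda>j. t k + j) ` ?J)" unfolding c_def by (rule card_Un_le)
    also have "card ((\<lambda>j. t k + j) ` ?J) \<le> card ?J" by (rule card_image_le) simp
    finally have "real (c (t (Suc k))) \<le> real (c (t k)) + real (card ?J)" by linarith
    also have "\<dots> \<le> (real (t k0) + e * real (t k)) + e * real (2 * k + 1)"
      by (intro add_mono step.IH x(2) step.hyps)
    finally show ?case by (simp add: t_Suc algebra_simps)
  qed
  have "dbar f g \<le> e"
    unfolding dbar_le_iff
  proof (rule upper_density_leI, intro exI allI)
    fix d :: real and T assume "e < d"
    define s where "s = d - e"
    have "0 < s" using \<open>e < d\<close> by (simp add: s_def)
    define n where "n = block_index t T"
    have n: "t n \<le> T" "T < t (Suc n)" using block_index_bounds[OF mono t_0] by (auto simp: n_def)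
    \<comment> \<open>\<open>c_block\<close> starts at \<open>k0\<close>; the maximum also covers
      positions \<open>T\<close> before it, at the price of the constant
      \<open>e * t k0\<close>.\<close>
    have "t (Suc n) \<le> t (max k0 (Suc n))" using mono by (simp add: strict_mono_less_eq)
    then have "c T \<le> c (t (max k0 (Suc n)))" using n by (intro c_mono) linarith
    also have "real (c (t (max k0 (Suc n)))) \<le> real (t k0) + e * real (t (max k0 (Suc n)))"
      by (rule c_block) simp
    also have "\<dots> \<le> real (t k0) + e * (real (t k0) + real (t (Suc n)))"
      using \<open>0 \<le> e\<close> by (intro add_left_mono mult_left_mono) (auto simp: max_def)
    also have "e * (real (t k0) + real (t (Suc n))) = e * real (t k0) + e * real (t n) + (2 * e * real n + e)"
      by (simp add: t_Suc algebra_simps)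
    \<comment> \<open>The unfinished block costs an amount linear in \<open>n\<close>, while
      \<open>t n = n ^ 2\<close>: expanding \<open>(s * n - e) ^ 2 \<ge> 0\<close> absorbs it into
      the slack \<open>s * t n\<close> and a constant.\<close>
    also have "2 * e * real n \<le> s * real (t n) + e ^ 2 / s"
    proof -
      have "0 \<le> (s * real n - e) ^ 2 / s" using \<open>0 < s\<close> by simp
      also have "\<dots> = s * real (t n) + e ^ 2 / s - 2 * e * real n"
        using \<open>0 < s\<close> by (simp add: t_def power2_eq_square field_simps)
      finally show ?thesis by simp
    qed
    finally have "real (c T) \<le> (e + s) * real (t n) + (real (t k0) + e * real (t k0) + e ^ 2 / s + e)"
      by (simp add: algebra_simps)
    also have "(e + s) * real (t n) \<le> d * real T"
      using n \<open>0 \<le> e\<close> \<open>e < d\<close> by (auto simp: s_def intro!: mult_left_mono)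
    finally show "real (card ({i. f i \<noteq> g i} \<inter> {..<T})) \<le> d * real T + (real (t k0) + e * real (t k0) + e ^ 2 / (d - e) + e)"
      unfolding c_def s_def by simp
  qed
  then have "dbar z g \<le> e" using dbar_triangle[of z g f] z(2) by linarith
  then show ?thesis using z(1) by blast
qed

text \<open>The cuts are the starting positions of the words. They let a concatenation be cut up and
  spliced again without reference to the words.\<close>

lemma infinite_concat_cuts:
  assumes X: "shift_space X" and "1 \<le> N" and w: "\<And>i. w i \<in> language X" "\<And>i. N \<le> length (w i)"
  obtains B where "\<And>x y. x \<in> B \<Longrightarrow> y \<in> B \<Longrightarrow> x < y \<Longrightarrow> x + N \<le> y"
    and "\<And>i K. B \<inter> {i<..<i + K} = {} \<Longrightarrow> admissible X (infinite_concat w) i K"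
proof -
  define b where "b k = length (concat (map w [0..<k]))" for k
  have b_0: "b 0 = 0" and b_Suc: "\<And>k. b (Suc k) = b k + length (w k)" by (simp_all add: b_def)
  have pos: "0 < length (w k)" for k using \<open>1 \<le> N\<close> w(2)[of k] by linarith
  have mono: "strict_mono b" by (rule strict_mono_Suc_iff[THEN iffD2]) (use pos in \<open>simp add: b_Suc\<close>)
  have "admissible X (infinite_concat w) (b k) (b (Suc k) - b k)" for k
  proof -
    obtain x where "x \<in> X" "\<And>j. j < length (w k) \<Longrightarrow> x j = w k ! j"
      using w(1)[of k] unfolding language_iff by blast
    moreover have "infinite_concat w (b k + j) = w k ! j" if "j < length (w k)" for j
      unfolding b_def using that pos by (intro infinite_concat_block) auto
    ultimately show ?thesis unfolding admissible_def b_Suc by (intro bexI[of _ x]) simp_all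
  qed
  then have cuts: "\<And>i K. range b \<inter> {i<..<i + K} = {} \<Longrightarrow> admissible X (infinite_concat w) i K"
    by (rule admissible_within_blocks[OF X mono b_0])
  have sep: "b m + N \<le> b n" if "b m < b n" for m n
  proof -
    have "b (Suc m) \<le> b n" using that mono by (simp add: strict_mono_less strict_mono_less_eq)
    then show ?thesis using w(2)[of m] by (simp add: b_Suc)
  qed
  have "x + N \<le> y" if "x \<in> range b" "y \<in> range b" "x < y" for x y
    using that sep by (elim rangeE) simp
  then show ?thesis using cuts by (rule that)
qed

text \<open>A finite witness against shadowing. For positive \<open>e\<close> the segment is not
  itself a word of the language, so its cuts \<open>B\<close> are carried along for splicing;
  \<open>R\<close> lets arbitrarily long segments be requested.\<close>

definition unshadowed_segment ::
    "binseq set \<Rightarrow> real \<Rightarrow> nat \<Rightarrow> nat \<Rightarrow> binseq \<Rightarrow> nat \<Rightarrow> nat set \<Rightarrow> bool" where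
  "unshadowed_segment X e N R h l B \<longleftrightarrow> R \<le> l \<and>
     (\<forall>x\<in>X. e / 2 * real l < real (card {j. j < l \<and> h j \<noteq> x j})) \<and>
     (\<forall>x\<in>B. \<forall>y\<in>B. x < y \<longrightarrow> x + N \<le> y) \<and>
     (\<forall>i K. B \<inter> {i<..<i + K} = {} \<longrightarrow> admissible X h i K)"

text \<open>If all square blocks of the concatenation from index \<open>R\<close> on were within
  proportion \<open>e / 2\<close> of \<open>X\<close>, a point of \<open>X\<close> would trace it
  with \<open>dbar\<close> at most \<open>e / 2\<close>, against \<open>far\<close>. A block that
  fails this, re-indexed to start at 0, is the segment.\<close>

lemma ex_unshadowed_segment:
  assumes X: "shift_space X" and traceable: "traceable X" and "1 \<le> N" "0 < e"
    and w: "\<And>i. w i \<in> language X" "\<And>i. N \<le> length (w i)"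
    and far: "\<And>x. x \<in> X \<Longrightarrow> e \<le> dbar x (infinite_concat w)"
  shows "\<exists>h l B. unshadowed_segment X e N R h l B"
proof -
  obtain C where C: "\<And>x y. x \<in> C \<Longrightarrow> y \<in> C \<Longrightarrow> x < y \<Longrightarrow> x + N \<le> y"
    "\<And>i K. C \<inter> {i<..<i + K} = {} \<Longrightarrow> admissible X (infinite_concat w) i K"
    by (rule infinite_concat_cuts[where w = w, OF X \<open>1 \<le> N\<close> w]) blast
  define g where "g = infinite_concat w"
  have "\<not> (\<forall>k\<ge>R. \<exists>x\<in>X. real (card {j. j < 2 * k + 1 \<and> g (k ^ 2 + j) \<noteq> x j}) \<le> e / 2 * real (2 * k + 1))"
  proof
    assume "\<forall>k\<ge>R. \<exists>x\<in>X. real (card {j. j < 2 * k + 1 \<and> g (k ^ 2 + j) \<noteq> x j}) \<le> e / 2 * real (2 * k + 1)"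
    then have "\<exists>z\<in>X. dbar z g \<le> e / 2"
      using \<open>0 < e\<close> by (intro dbar_tracing_of_close_square_blocks[OF X traceable, of _ R]) auto
    then obtain z where "z \<in> X" "dbar z g \<le> e / 2" by blast
    then show False using far[of z] \<open>0 < e\<close> unfolding g_def by linarith
  qed
  then obtain k where "R \<le> k"
    and k: "\<And>x. x \<in> X \<Longrightarrow> e / 2 * real (2 * k + 1) < real (card {j. j < 2 * k + 1 \<and> g (k ^ 2 + j) \<noteq> x j})"
    unfolding not_all not_imp bex_simps not_le by blast
  have "unshadowed_segment X e N R (\<lambda>j. g (k ^ 2 + j)) (2 * k + 1) {i. k ^ 2 + i \<in> C}"
    unfolding unshadowed_segment_def
  proof (intro conjI ballI allI impI)
    show "R \<le> 2 * k + 1" using \<open>R \<le> k\<close> by simp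
    show "e / 2 * real (2 * k + 1) < real (card {j. j < 2 * k + 1 \<and> g (k ^ 2 + j) \<noteq> x j})" if "x \<in> X" for x
      using that by (rule k)
    show "x + N \<le> y" if "x \<in> {i. k ^ 2 + i \<in> C}" "y \<in> {i. k ^ 2 + i \<in> C}" "x < y" for x y
      using C(1)[of "k ^ 2 + x" "k ^ 2 + y"] that by simp
    show "admissible X (\<lambda>j. g (k ^ 2 + j)) i K" if "{i. k ^ 2 + i \<in> C} \<inter> {i<..<i + K} = {}" for i K
    proof -
      have "C \<inter> {k ^ 2 + i<..<k ^ 2 + i + K} = {}"
      proof (rule equals0I)
        fix c assume c: "c \<in> C \<inter> {k ^ 2 + i<..<k ^ 2 + i + K}"
        then have "c - k ^ 2 \<in> {i. k ^ 2 + i \<in> C} \<inter> {i<..<i + K}" by auto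
        then show False using that by simp
      qed
      then have "admissible X g (k ^ 2 + i) K" unfolding g_def by (rule C(2))
      then show ?thesis by (simp add: admissible_def add.assoc)
    qed
  qed
  then show ?thesis by blast
qed

text \<open>Segments for \<open>N = n + 1\<close> are spliced, each longer than everything before
  it. Their growing separation makes all cuts together sparse, so some point traces the splice; yet
  each segment costs that point a fixed proportion of the positions up to its end.\<close>

lemma dbar_shadowing_if_traceable:
  assumes X: "shift_space X" and traceable: "traceable X"
  shows "dbar_shadowing X"
proof (rule ccontr)
  assume "\<not> dbar_shadowing X"
  then obtain e where "0 < e" and e: "\<not> (\<exists>N\<ge>1. \<forall>w. (\<forall>i. w i \<in> language X \<and> N \<le> length (w i)) \<longrightarrow>
      (\<exists>x\<in>X. dbar x (infinite_concat w) < e))"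
    unfolding dbar_shadowing_def not_all not_imp by (elim exE conjE)
  have "\<exists>h l B. unshadowed_segment X e N R h l B" if "1 \<le> N" for N R
  proof -
    have "\<exists>w. (\<forall>i. w i \<in> language X \<and> N \<le> length (w i)) \<and> \<not> (\<exists>x\<in>X. dbar x (infinite_concat w) < e)"
      using e \<open>1 \<le> N\<close> by blast
    then obtain w where "\<forall>i. w i \<in> language X \<and> N \<le> length (w i)" "\<not> (\<exists>x\<in>X. dbar x (infinite_concat w) < e)"
      by (elim exE conjE)
    then have w: "\<And>i. w i \<in> language X" "\<And>i. N \<le> length (w i)"
      "\<And>x. x \<in> X \<Longrightarrow> e \<le> dbar x (infinite_concat w)"
      by (auto simp: not_less)
    show ?thesis by (rule ex_unshadowed_segment[where w = w, OF X traceable \<open>1 \<le> N\<close> \<open>0 < e\<close> w])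
  qed
  then have "\<forall>n R. \<exists>h l B. unshadowed_segment X e (Suc n) R h l B" by simp
  then obtain h l B where segment: "\<And>n R. unshadowed_segment X e (Suc n) R (h n R) (l n R) (B n R)" by metis
  \<comment> \<open>The requested length \<open>a + n + 1\<close> exceeds the start \<open>a\<close>
    of the segment, so the segment fills more than half of everything up to its end, and block
    lengths tend to infinity.\<close>
  define t where "t = rec_nat 0 (\<lambda>n a. a + l n (a + n + 1))"
  define L where "L n = l n (t n + n + 1)" for n
  define H where "H n = h n (t n + n + 1)" for n
  define C where "C n = B n (t n + n + 1)" for n
  have t_0: "t 0 = 0" and t_Suc: "\<And>n. t (Suc n) = t n + L n"
    by (simp_all add: t_def L_def)
  have "unshadowed_segment X e (Suc n) (t n + n + 1) (H n) (L n) (C n)" for n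
    unfolding H_def L_def C_def by (rule segment)
  then have L: "t n + n + 1 \<le> L n"
    and H: "x \<in> X \<Longrightarrow> e / 2 * real (L n) < real (card {j. j < L n \<and> H n j \<noteq> x j})"
    and C_sep: "a \<in> C n \<Longrightarrow> b \<in> C n \<Longrightarrow> a < b \<Longrightarrow> a + Suc n \<le> b"
    and C_cuts: "C n \<inter> {i<..<i + K} = {} \<Longrightarrow> admissible X (H n) i K" for n x a b i K
    unfolding unshadowed_segment_def by (blast, blast, blast, blast)
  have "0 < L n" for n using L[of n] by linarith
  then have mono: "strict_mono t" by (simp add: strict_mono_Suc_iff t_Suc)
  let ?n = "block_index t"
  define f where "f i = H (?n i) (i - t (?n i))" for i
  have f: "f i = H n (i - t n)" if "t n \<le> i" "i < t (Suc n)" for n i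
    using block_index_eq[OF mono that] by (simp add: f_def)
  \<comment> \<open>Cuts of neighbouring blocks may lie close together across their common end, so the cuts are
    split by the parity of the block.\<close>
  define E where "E p = {i. even (?n i) = p \<and> i - t (?n i) \<in> C (?n i)}" for p
  have E_sparse: "upper_density_le (E p) 0" for p
  proof (rule upper_density_0_sparse)
    fix M
    have "x + M \<le> y" if x: "x \<in> E p" and y: "y \<in> E p" and xy: "t M \<le> x" "x < y" for x y
    proof -
      have bx: "t (?n x) \<le> x" "x < t (Suc (?n x))" and bys: "t (?n y) \<le> y" "y < t (Suc (?n y))"
        using block_index_bounds[OF mono t_0] by auto
      have "t M < t (Suc (?n x))" "t (?n x) < t (Suc (?n y))" using xy bx bys by linarith+
      then have "M \<le> ?n x" "?n x \<le> ?n y" using mono by (auto simp: strict_mono_less)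
      show ?thesis
      proof (cases "?n x = ?n y")
        case True
        have "x - t (?n x) + Suc (?n x) \<le> y - t (?n x)"
          using x y xy bx True by (intro C_sep) (auto simp: E_def)
        then show ?thesis using \<open>M \<le> ?n x\<close> bx bys True by linarith
      next
        \<comment> \<open>Equal parity and distinct indices leave a whole block between
          \<open>x\<close> and \<open>y\<close>, and that block is longer than
          \<open>M\<close>.\<close>
        case False
        moreover have "even (?n x) = even (?n y)" using x y by (simp add: E_def)
        ultimately have "Suc (Suc (?n x)) \<le> ?n y"
          using \<open>?n x \<le> ?n y\<close> by (metis Suc_leI even_Suc le_neq_implies_less)
        then have "t (Suc (Suc (?n x))) \<le> t (?n y)" using mono by (simp add: strict_mono_less_eq)
        moreover have "t (Suc (Suc (?n x))) = t (Suc (?n x)) + L (Suc (?n x))" by (rule t_Suc)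
        ultimately show ?thesis using L[of "Suc (?n x)"] \<open>M \<le> ?n x\<close> bx bys by linarith
      qed
    qed
    then show "\<exists>N. \<forall>x\<in>E p. \<forall>y\<in>E p. N \<le> x \<and> x < y \<longrightarrow> x + M \<le> y" by (intro exI[of _ "t M"]) simp
  qed
  have "asymp_admissible X f"
  proof (rule asymp_admissible_if_cuts)
    have gap: "t n + M \<le> t (Suc n)" if "M \<le> n" for M n using L[of n] that unfolding t_Suc by linarith
    have "upper_density_le (range t) 0"
      by (rule upper_density_0_range_gaps[OF mono]) (use gap in blast)
    then show "upper_density_le (range t \<union> (E True \<union> E False)) 0" by (intro upper_density_0_Un E_sparse)
  next
    fix i K assume cuts: "(range t \<union> (E True \<union> E False)) \<inter> {i<..<i + K} = {}"
    define n where "n = ?n i"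
    have n: "t n \<le> i" "i < t (Suc n)" using block_index_bounds[OF mono t_0] by (auto simp: n_def)
    have le: "i + K \<le> t (Suc n)"
    proof (rule ccontr)
      assume "\<not> i + K \<le> t (Suc n)"
      then have "t (Suc n) \<in> range t \<inter> {i<..<i + K}" using n by simp
      then show False using cuts by blast
    qed
    \<comment> \<open>A cut \<open>c\<close> of the segment inside the window would reappear as
      \<open>t n + c\<close> in \<open>E\<close>; its block index is still \<open>n\<close> because
      the window ends by \<open>t (Suc n)\<close>.\<close>
    have "C n \<inter> {i - t n<..<i - t n + K} = {}"
    proof (rule equals0I)
      fix c assume c: "c \<in> C n \<inter> {i - t n<..<i - t n + K}"
      then have tc: "t n + c \<in> {i<..<i + K}" using n by auto
      then have "?n (t n + c) = n" using le n by (intro block_index_eq[OF mono]) auto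
      then have "t n + c \<in> E (even n)" using c by (simp add: E_def)
      then have "t n + c \<in> E True \<union> E False" by (cases "even n") auto
      then show False using cuts tc by blast
    qed
    then have "admissible X (H n) (i - t n) K" by (rule C_cuts)
    moreover have "H n (i - t n + j) = f (i + j)" if "j < K" for j
      using f[of n "i + j"] that n le by simp
    ultimately show "admissible X f i K" by (simp add: admissible_def)
  qed
  then obtain z where z: "z \<in> X" "dbar z f = 0" using traceable unfolding traceable_def by blast
  \<comment> \<open>Any proportion below \<open>e / 4\<close> serves: since
    \<open>t (Suc n) \<le> 2 * L n\<close>, tracing permits at most \<open>2 * e / 5 * L n\<close>
    mismatches, fewer than the \<open>e / 2 * L n\<close> forced by the segment.\<close>
  have "\<forall>\<^sub>F T in sequentially. real (card ({i. z i \<noteq> f i} \<inter> {..<T})) \<le> e / 5 * real T"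
    using z(2) \<open>0 < e\<close> by (intro dbar_less_eventually) simp
  then obtain T0 where T0: "\<And>T. T0 \<le> T \<Longrightarrow> real (card ({i. z i \<noteq> f i} \<inter> {..<T})) \<le> e / 5 * real T"
    unfolding eventually_sequentially by blast
  define n where "n = T0"
  have "T0 \<le> t (Suc n)" using L[of n] unfolding t_Suc n_def by linarith
  have "e / 2 * real (L n) < real (card {j. j < L n \<and> H n j \<noteq> z (t n + j)})"
    by (rule H) (rule shift_space_closed_shift[OF X z(1)])
  also have "card {j. j < L n \<and> H n j \<noteq> z (t n + j)} \<le> card ({i. z i \<noteq> f i} \<inter> {..<t (Suc n)})"
  proof (rule card_inj_on_le[where f = "\<lambda>j. t n + j"])
    show "(\<lambda>j. t n + j) ` {j. j < L n \<and> H n j \<noteq> z (t n + j)} \<subseteq> {i. z i \<noteq> f i} \<inter> {..<t (Suc n)}"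
    proof (rule image_subsetI)
      fix j assume j: "j \<in> {j. j < L n \<and> H n j \<noteq> z (t n + j)}"
      then have "f (t n + j) = H n j" using f[of n "t n + j"] by (simp add: t_Suc)
      then show "t n + j \<in> {i. z i \<noteq> f i} \<inter> {..<t (Suc n)}" using j by (auto simp: t_Suc)
    qed
  qed (auto simp: inj_on_def)
  also have "real (card ({i. z i \<noteq> f i} \<inter> {..<t (Suc n)})) \<le> e / 5 * real (t (Suc n))"
    by (rule T0) fact
  also have "\<dots> \<le> e / 5 * real (2 * L n)"
    using L[of n] \<open>0 < e\<close> by (intro mult_left_mono) (simp_all add: t_Suc)
  finally have "e * real (L n) < 0" by simp
  then show False using \<open>0 < e\<close> by (simp add: mult_less_0_iff)
qed

theorem mainTheorem5:
  fixes X :: "(nat \<Rightarrow> bool) set"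
  assumes "shift_space X"
    and "shift ` X = X"
  shows "vague_specification X \<longleftrightarrow> dbar_complete X \<and> dbar_shadowing X"
  using vague_specification_iff_traceable[OF assms(1)] traceable_if_complete_shadowing[OF assms(1)]
    dbar_complete_if_traceable[OF assms(1)] dbar_shadowing_if_traceable[OF assms(1)]
  by blast

end
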